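(* Let $l\in\{+1,-1\}$ and let $\Gamma_l\subset D^l$ be a $K_B$-bounded contour satisfying $$\mathrm{Var}_{\widetilde A_1}(B,\Gamma_l)<1,\qquad \mathrm{Var}_{\widetilde A_1}(B,\Gamma_l)\,\|\widetilde A_1\|<\tfrac14\,d_0(\Gamma_l)\,[1-\mathrm{Var}_{\widetilde A_1}(B,\Gamma_l)]^2 .$$ Suppose $X^{(l)}$ is the solution of the equation $X=V_1(\widetilde A_1+X,\Gamma_l)$, $\|X^{(l)}\|\le r_0(B)$, and $H_1^{(l)}=\widetilde A_1+X^{(l)}$. Then, for $z\in\mathbb{C}\setminus\Gamma_l$, the transfer function $M_1(z,\Gamma_l)$ admits the factorization $$M_1(z,\Gamma_l)=W_1(z,\Gamma_l)\,(H_1^{(l)}-z),$$ where $W_1(z,\Gamma_l)$ is a bounded operator in $\mathcal H_1$, $$W_1(z,\Gamma_l)=I_1-\int_{\Gamma_l}d\mu\,K_B'(\mu)(H_1^{(l)}-\mu)^{-1}+z\int_{\Gamma_l}d\mu\,K_B'(\mu)(z-\mu)^{-1}(H_1^{(l)}-\mu)^{-1}.$$ If $\operatorname{dist}\{z,\sigma(\widetilde A_1)\}\le d_0(\Gamma_l)[1-\mathrm{Var}_{\widetilde A_1}(B,\Gamma_l)]/2$, then the operator $W_1(z,\Gamma_l)$ is boundedly invertible and $$\left\|[W_1(z,\Gamma_l)]^{-1}\right\|\le\left(1-\frac{4\,\mathrm{Var}_{\widetilde A_1}(B,\Gamma_l)\,[d_0(\Gamma_l)+\|\widetilde A_1\|]}{d_0(\Gamma_l)\,[1+\mathrm{Var}_{\widetilde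 A_1}(B,\Gamma_l)]^2}\right)^{-1}<\infty .$$
   Context: Setting. $\mathcal H_0,\mathcal H_1$ are separable Hilbert spaces; $I_1$ is the identity in $\mathcal H_1$. $A_0$ is an unbounded selfadjoint operator in $\mathcal H_0$ whose spectrum is absolutely continuous and equal to $\Delta_0=[\alpha_0,+\infty)$, $\alpha_0>0$. $A_1$ is a bounded selfadjoint operator in $\mathcal H_1$. The (possibly unbounded) operators $T_{ij}:\mathcal H_j\to\mathcal H_i$ ($i,j\in\{0,1\}$, $i\ne j$) satisfy $T_{01}^*=T_{10}$ and $\mathcal D(T_{10})\supset\mathcal D(A_0^{1/2})$. Then $B_{10}:=T_{10}A_0^{-1/2}$ is bounded; put $B_{01}:=B_{10}^*$. Let $\widetilde A_1:=A_1-B_{10}B_{01}$, a bounded selfadjoint operator in $\mathcal H_1$; it is assumed that $\sigma(\widetilde A_1)\subset\Delta_0$. The function $K_B$. Let $E_0$ be the spectral measure of $A_0$, $E^0(\mu):=E_0([\alpha_0,\mu))$ and $K_B(\mu):=B_{10}E^0(\mu)B_{01}$. It is assumed that: $K_B$ is differentiable on $\Delta_0$ in the operator norm topology; $K_B'$ is continuous within $\Delta_0$ and admits analytic continuation (in the operator norm topology) from $\Delta_0$ to a simply connected domain $D^+\subset\mathbb{C}^+$ (the upper half-plane) whose boundary includes the entire interval $\Delta_0$. Consequently it is also continued to $D^-:=\{z:\overline z\in D^+\}$, and $[K_B'(\mu)]^*=K_B'(\overline\mu)$ for $\mu\in D^\pm$; the continuations are again denoted $K_B'$. It is assumed that $\|K_B'(\mu)\|\le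 C|\mu-\alpha_0|^{\gamma}$, $\mu\in D^\pm$, for some $C>0$ and $\gamma\in(-1,0]$. For $l=\pm1$ write $D^l$ for $D^\pm$. Contours. $\Gamma_l$ denotes a rectifiable Jordan curve in $D^l$ resulting from continuous deformation of the interval $\Delta_0$, the finite end point $\alpha_0$ being fixed (oriented from $\alpha_0$ to infinity). It is called $K_B$-bounded if $\mathrm{Var}_1(B,\Gamma_l):=\int_{\Gamma_l}|d\mu|\,(1+|\mu|)^{-1}\|K_B'(\mu)\|<\infty$, where $|d\mu|$ is Lebesgue (arc-length) measure on $\Gamma_l$. Put $d_0(\Gamma_l):=\operatorname{dist}\{\sigma(\widetilde A_1),\Gamma_l\}$, assumed positive, and $\mathrm{Var}_{\widetilde A_1}(B,\Gamma_l):=\int_{\Gamma_l}|d\mu|\,\|K_B'(\mu)\|/\operatorname{dist}\{\mu,\sigma(\widetilde A_1)\}$ (which is then finite). Transfer function. For $z\in\mathbb{C}\setminus\Gamma_l$, $M_1(z,\Gamma_l):=\widetilde A_1-z+\int_{\Gamma_l}d\mu\,K_B'(\mu)\frac{z}{z-\mu}$. Basic equation. For a bounded operator $Y$ in $\mathcal H_1$ whose spectrum is separated from $\Gamma_l$, $V_1(Y,\Gamma_l):=\int_{\Gamma_l}d\mu\,K_B'(\mu)\,Y(Y-\mu)^{-1}$. Put $$r_{\min}(\Gamma_l):=\tfrac12 d_0(\Gamma_l)[1-\mathrm{Var}_{\widetilde A_1}(B,\Gamma_l)]-\sqrt{\tfrac14 d_0^2(\Gamma_l)[1-\mathrm{Var}_{\widetilde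 A_1}(B,\Gamma_l)]^2-d_0(\Gamma_l)\mathrm{Var}_{\widetilde A_1}(B,\Gamma_l)\|\widetilde A_1\|},$$ $\omega(B,\Gamma_l):=d_0(\Gamma_l)[1-\mathrm{Var}_{\widetilde A_1}(B,\Gamma_l)]^2-4\|\widetilde A_1\|\mathrm{Var}_{\widetilde A_1}(B,\Gamma_l)$, and $$r_0(B):=\inf\{r_{\min}(\Gamma_l):\ \Gamma_l\ K_B\text{-bounded},\ \mathrm{Var}_{\widetilde A_1}(B,\Gamma_l)<1,\ \omega(B,\Gamma_l)>0\},$$ whose value does not depend on $l=\pm1$. For a $K_B$-bounded $\Gamma_l$ satisfying the two inequalities $\mathrm{Var}_{\widetilde A_1}(B,\Gamma_l)<1$ and $\omega(B,\Gamma_l)>0$ the equation $X=V_1(\widetilde A_1+X,\Gamma_l)$ has a unique solution in the ball $\|X\|\le r_{\min}(\Gamma_l)$; $X^{(l)}$ denotes this solution. For given $l$ it is the same for all such $\Gamma_l\subset D^l$, and $\|X^{(l)}\|\le r_0(B)$. *)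

theory Defs
  imports "HOL-Analysis.Analysis"
begin

text \<open>
  Complex Hilbert spaces. The inner product is linear in its first argument; the real structure
  of the superclasses is the one obtained by restriction of scalars, so norm, topology,
  completeness, bounded operators and their operator norm are those of the library.
\<close>

class complex_hilbert = real_inner + banach +
  fixes scaleC :: "complex \<Rightarrow> 'a \<Rightarrow> 'a" (infixr \<open>*\<^sub>C\<close> 75)
    and cinner :: "'a \<Rightarrow> 'a \<Rightarrow> complex"
  assumes scaleC_add_right: "a *\<^sub>C (x + y) = a *\<^sub>C x + a *\<^sub>C y"
    and scaleC_add_left: "(a + b) *\<^sub>C x = a *\<^sub>C x + b *\<^sub>C x"
    and scaleC_scaleC: "a *\<^sub>C (b *\<^sub>C x) = (a * b) *\<^sub>C x"
    and scaleC_of_real: "complex_of_real r *\<^sub>C x = r *\<^sub>R x"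
    and cinner_commute: "cinner x y = cnj (cinner y x)"
    and cinner_add_left: "cinner (x + y) z = cinner x z + cinner y z"
    and cinner_scaleC_left: "cinner (a *\<^sub>C x) y = a * cinner x y"
    and Re_cinner: "Re (cinner x y) = inner x y"

lemma norm_scaleC: "norm (a *\<^sub>C x) = cmod a * norm (x :: 'a::complex_hilbert)"
proof -
  have r: "cinner u (a *\<^sub>C v) = cnj a * cinner u v" for u v :: 'a
    by (metis cinner_commute cinner_scaleC_left complex_cnj_mult)
  have "(norm (a *\<^sub>C x))\<^sup>2 = Re (a * cnj a * cinner x x)"
    by (simp only: power2_norm_eq_inner Re_cinner[symmetric] r cinner_scaleC_left) (simp only: ac_simps)
  also have "a * cnj a = complex_of_real ((cmod a)\<^sup>2)"
    by (rule complex_norm_square[symmetric])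
  also have "Re (complex_of_real ((cmod a)\<^sup>2) * cinner x x) = (cmod a * norm x)\<^sup>2"
    by (simp add: Re_cinner power2_norm_eq_inner power_mult_distrib del: of_real_power)
  finally show ?thesis by (simp add: power2_eq_iff_nonneg)
qed

lemma bounded_linear_scaleC: "bounded_linear (\<lambda>x :: 'a::complex_hilbert. a *\<^sub>C x)"
proof (rule bounded_linear_intro[where K = "cmod a"])
  show "a *\<^sub>C (r *\<^sub>R x) = r *\<^sub>R (a *\<^sub>C x)" for r and x :: 'a
    by (metis mult.commute scaleC_of_real scaleC_scaleC)
qed (simp_all add: scaleC_add_right norm_scaleC mult.commute)

subsection \<open>Bounded operators\<close>

text \<open>
  The library type of bounded operators consists of the real-linear ones; complex linearity is
  stated separately, except that any operator possessing an adjoint in the sense of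
  \<open>is_adjoint\<close> is automatically complex linear.
\<close>

definition complex_linear :: "('a::complex_hilbert \<Rightarrow>\<^sub>L 'b::complex_hilbert) \<Rightarrow> bool" where
  "complex_linear T \<longleftrightarrow> (\<forall>a x. T (a *\<^sub>C x) = a *\<^sub>C T x)"

lift_definition scalar_op :: "complex \<Rightarrow> 'a::complex_hilbert \<Rightarrow>\<^sub>L 'a" is "\<lambda>a x. a *\<^sub>C x"
  by (rule bounded_linear_scaleC)

definition scale_op ::
  "complex \<Rightarrow> ('a::real_normed_vector \<Rightarrow>\<^sub>L 'b::complex_hilbert) \<Rightarrow> 'a \<Rightarrow>\<^sub>L 'b" (infixr \<open>\<cdot>\<^sub>C\<close> 76) where
  "a \<cdot>\<^sub>C T = scalar_op a o\<^sub>L T"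

definition is_adjoint ::
  "('a::complex_hilbert \<Rightarrow>\<^sub>L 'b::complex_hilbert) \<Rightarrow> ('b \<Rightarrow>\<^sub>L 'a) \<Rightarrow> bool" where
  "is_adjoint T S \<longleftrightarrow> (\<forall>x y. cinner (T x) y = cinner x (S y))"

definition is_inverse :: "('a::real_normed_vector \<Rightarrow>\<^sub>L 'a) \<Rightarrow> ('a \<Rightarrow>\<^sub>L 'a) \<Rightarrow> bool" where
  "is_inverse T S \<longleftrightarrow> T o\<^sub>L S = id_blinfun \<and> S o\<^sub>L T = id_blinfun"

definition op_invertible :: "('a::real_normed_vector \<Rightarrow>\<^sub>L 'a) \<Rightarrow> bool" where
  "op_invertible T \<longleftrightarrow> (\<exists>S. is_inverse T S)"

definition op_inverse :: "('a::real_normed_vector \<Rightarrow>\<^sub>L 'a) \<Rightarrow> 'a \<Rightarrow>\<^sub>L 'a" where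
  "op_inverse T = (THE S. is_inverse T S)"

definition op_spectrum :: "('a::complex_hilbert \<Rightarrow>\<^sub>L 'a) \<Rightarrow> complex set" where
  "op_spectrum T = {z. \<not> op_invertible (T - scalar_op z)}"

definition resolvent :: "('a::complex_hilbert \<Rightarrow>\<^sub>L 'a) \<Rightarrow> complex \<Rightarrow> 'a \<Rightarrow>\<^sub>L 'a" where
  "resolvent T z = op_inverse (T - scalar_op z)"

text \<open>Holomorphy with respect to the operator norm.\<close>

definition op_holomorphic_on ::
  "(complex \<Rightarrow> 'a::real_normed_vector \<Rightarrow>\<^sub>L 'b::complex_hilbert) \<Rightarrow> complex set \<Rightarrow> bool" where
  "op_holomorphic_on F S \<longleftrightarrow>
     (\<forall>z\<in>S. \<exists>F'. (F has_derivative (\<lambda>h. h \<cdot>\<^sub>C F')) (at z within S))"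

subsection \<open>Unbounded operators\<close>

text \<open>
  An unbounded operator is given by its domain \<open>D\<close> and a function \<open>T\<close>, whose values outside
  \<open>D\<close> are irrelevant.
\<close>

definition linear_operator ::
  "'a::complex_hilbert set \<Rightarrow> ('a \<Rightarrow> 'b::complex_hilbert) \<Rightarrow> bool" where
  "linear_operator D T \<longleftrightarrow>
     0 \<in> D \<and>
     (\<forall>x\<in>D. \<forall>y\<in>D. x + y \<in> D \<and> T (x + y) = T x + T y) \<and>
     (\<forall>a. \<forall>x\<in>D. a *\<^sub>C x \<in> D \<and> T (a *\<^sub>C x) = a *\<^sub>C T x)"

definition operator_adjoint ::
  "'a::complex_hilbert set \<Rightarrow> ('a \<Rightarrow> 'b::complex_hilbert) \<Rightarrow> 'b set \<Rightarrow> ('b \<Rightarrow> 'a) \<Rightarrow> bool" where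
  "operator_adjoint D T D' T' \<longleftrightarrow>
     closure D = UNIV \<and>
     D' = {y. \<exists>w. \<forall>x\<in>D. cinner (T x) y = cinner x w} \<and>
     (\<forall>x\<in>D. \<forall>y\<in>D'. cinner (T x) y = cinner x (T' y))"

definition selfadjoint_operator :: "'a::complex_hilbert set \<Rightarrow> ('a \<Rightarrow> 'a) \<Rightarrow> bool" where
  "selfadjoint_operator D A \<longleftrightarrow> linear_operator D A \<and> operator_adjoint D A D A"

definition operator_spectrum :: "'a::complex_hilbert set \<Rightarrow> ('a \<Rightarrow> 'a) \<Rightarrow> complex set" where
  "operator_spectrum D A = {z. \<not> (\<exists>R :: 'a \<Rightarrow>\<^sub>L 'a.
     (\<forall>y. R y \<in> D \<and> A (R y) - z *\<^sub>C R y = y) \<and> (\<forall>x\<in>D. R (A x - z *\<^sub>C x) = x))}"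

definition projection_valued_measure :: "(real set \<Rightarrow> 'a::complex_hilbert \<Rightarrow>\<^sub>L 'a) \<Rightarrow> bool" where
  "projection_valued_measure E \<longleftrightarrow>
     (\<forall>S\<in>sets borel. E S o\<^sub>L E S = E S \<and> is_adjoint (E S) (E S)) \<and>
     E UNIV = id_blinfun \<and>
     (\<forall>S :: nat \<Rightarrow> real set. range S \<subseteq> sets borel \<longrightarrow> disjoint_family S \<longrightarrow>
        (\<forall>x. (\<lambda>n. E (S n) x) sums E (\<Union>n. S n) x))"

definition spectral_distribution ::
  "(real set \<Rightarrow> 'a::complex_hilbert \<Rightarrow>\<^sub>L 'a) \<Rightarrow> 'a \<Rightarrow> real measure" where
  "spectral_distribution E x =
     measure_of UNIV (sets borel) (\<lambda>S. ennreal (Re (cinner (E S x) x)))"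

text \<open>
  The operator \<open>\<integral> f dE\<close> for real \<open>f\<close>: its domain, and (by polarization) its action through the
  quadratic form.
\<close>

definition spectral_domain ::
  "(real set \<Rightarrow> 'a::complex_hilbert \<Rightarrow>\<^sub>L 'a) \<Rightarrow> (real \<Rightarrow> real) \<Rightarrow> 'a set" where
  "spectral_domain E f = {x. (\<integral>\<^sup>+s. ennreal ((f s)\<^sup>2) \<partial>spectral_distribution E x) < \<infinity>}"

definition is_spectral_integral ::
  "(real set \<Rightarrow> 'a::complex_hilbert \<Rightarrow>\<^sub>L 'a) \<Rightarrow> (real \<Rightarrow> real) \<Rightarrow> 'a set \<Rightarrow> ('a \<Rightarrow> 'a) \<Rightarrow> bool" where
  "is_spectral_integral E f D T \<longleftrightarrow>
     D = spectral_domain E f \<and> linear_operator D T \<and>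
     (\<forall>x\<in>D. cinner (T x) x = complex_of_real (\<integral>s. f s \<partial>spectral_distribution E x))"

definition is_spectral_measure ::
  "(real set \<Rightarrow> 'a::complex_hilbert \<Rightarrow>\<^sub>L 'a) \<Rightarrow> 'a set \<Rightarrow> ('a \<Rightarrow> 'a) \<Rightarrow> bool" where
  "is_spectral_measure E D A \<longleftrightarrow>
     projection_valued_measure E \<and> is_spectral_integral E (\<lambda>s. s) D A"

definition absolutely_continuous_spectrum :: "(real set \<Rightarrow> 'a::complex_hilbert \<Rightarrow>\<^sub>L 'a) \<Rightarrow> bool" where
  "absolutely_continuous_spectrum E \<longleftrightarrow>
     (\<forall>x. absolutely_continuous lborel (spectral_distribution E x))"

subsection \<open>Contours\<close>

definition half_domain :: "complex set \<Rightarrow> int \<Rightarrow> complex set" where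
  "half_domain Dp l = (if l = 1 then Dp else cnj ` Dp)"

text \<open>
  \<open>\<Gamma>\<close>, restricted to \<open>{0..}\<close>, is obtained from the half-line \<open>[\<alpha>, \<infinity>)\<close> by a continuous deformation
  inside \<open>D \<union> (\<alpha>, \<infinity>)\<close> keeping both \<open>\<alpha>\<close> and the point at infinity of the Riemann sphere fixed;
  the latter is the uniform divergence in the last clause.
\<close>

definition deformation_of_half_line :: "real \<Rightarrow> complex set \<Rightarrow> (real \<Rightarrow> complex) \<Rightarrow> bool" where
  "deformation_of_half_line \<alpha> D \<Gamma> \<longleftrightarrow>
     (\<exists>h :: real \<times> real \<Rightarrow> complex.
        continuous_on ({0..1} \<times> {0..}) h \<and>
        (\<forall>t\<ge>0. h (0, t) = of_real (\<alpha> + t)) \<and>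
        (\<forall>t\<ge>0. h (1, t) = \<Gamma> t) \<and>
        (\<forall>s\<in>{0..1}. h (s, 0) = of_real \<alpha>) \<and>
        h ` ({0..1} \<times> {0<..}) \<subseteq> D \<union> of_real ` {\<alpha><..} \<and>
        (\<forall>R. \<exists>t0\<ge>0. \<forall>s\<in>{0..1}. \<forall>t\<ge>t0. R \<le> cmod (h (s, t))))"

text \<open>
  A contour is an infinite Jordan arc, each bounded piece of which has finite length,
  parametrized over \<open>{0..}\<close> by its arc length: it is 1-Lipschitz and has unit speed almost
  everywhere. Hence \<open>|d\<mu>|\<close> becomes \<open>dt\<close> and \<open>d\<mu>\<close> becomes \<open>\<Gamma>'(t) dt\<close>.
  The end point \<open>\<alpha>\<close> lies on the boundary of \<open>D\<close>, so only the rest of the arc is in \<open>D\<close>.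
\<close>

definition is_contour :: "real \<Rightarrow> complex set \<Rightarrow> (real \<Rightarrow> complex) \<Rightarrow> bool" where
  "is_contour \<alpha> D \<Gamma> \<longleftrightarrow>
     \<Gamma> 0 = of_real \<alpha> \<and> \<Gamma> ` {0<..} \<subseteq> D \<and> inj_on \<Gamma> {0..} \<and>
     1-lipschitz_on {0..} \<Gamma> \<and>
     (AE t in lborel. 0 < t \<longrightarrow>
        \<Gamma> differentiable (at t) \<and> cmod (vector_derivative \<Gamma> (at t)) = 1) \<and>
     deformation_of_half_line \<alpha> D \<Gamma>"

text \<open>Integrals \<open>\<integral> d\<mu> F(\<mu>)\<close> of operator-valued functions, taken in the operator norm.\<close>

definition op_contour_integrable ::
  "(real \<Rightarrow> complex) \<Rightarrow> (complex \<Rightarrow> 'a::complex_hilbert \<Rightarrow>\<^sub>L 'a) \<Rightarrow> bool" where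
  "op_contour_integrable \<Gamma> F \<longleftrightarrow>
     (\<lambda>t. vector_derivative \<Gamma> (at t) \<cdot>\<^sub>C F (\<Gamma> t)) integrable_on {0..}"

definition op_contour_integral ::
  "(real \<Rightarrow> complex) \<Rightarrow> (complex \<Rightarrow> 'a::complex_hilbert \<Rightarrow>\<^sub>L 'a) \<Rightarrow> 'a \<Rightarrow>\<^sub>L 'a" where
  "op_contour_integral \<Gamma> F =
     integral {0..} (\<lambda>t. vector_derivative \<Gamma> (at t) \<cdot>\<^sub>C F (\<Gamma> t))"

subsection \<open>Quantities attached to a contour\<close>

text \<open>Below \<open>K\<close> is the continued derivative \<open>K\<^sub>B'\<close> and \<open>A\<close> is the operator \<open>A\<^sub>1 - B\<^sub>1\<^sub>0 B\<^sub>0\<^sub>1\<close>.\<close>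

definition K_bounded ::
  "(complex \<Rightarrow> 'a::complex_hilbert \<Rightarrow>\<^sub>L 'a) \<Rightarrow> (real \<Rightarrow> complex) \<Rightarrow> bool" where
  "K_bounded K \<Gamma> \<longleftrightarrow>
     (\<integral>\<^sup>+t\<in>{0..}. ennreal (norm (K (\<Gamma> t)) / (1 + cmod (\<Gamma> t))) \<partial>lborel) < \<infinity>"

definition d0 :: "('a::complex_hilbert \<Rightarrow>\<^sub>L 'a) \<Rightarrow> (real \<Rightarrow> complex) \<Rightarrow> real" where
  "d0 A \<Gamma> = setdist (op_spectrum A) (\<Gamma> ` {0..})"

definition VarA ::
  "(complex \<Rightarrow> 'a::complex_hilbert \<Rightarrow>\<^sub>L 'a) \<Rightarrow> ('a \<Rightarrow>\<^sub>L 'a) \<Rightarrow> (real \<Rightarrow> complex) \<Rightarrow> real" where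
  "VarA K A \<Gamma> = (LINT t:{0..}|lborel. norm (K (\<Gamma> t)) / infdist (\<Gamma> t) (op_spectrum A))"

definition r_min ::
  "(complex \<Rightarrow> 'a::complex_hilbert \<Rightarrow>\<^sub>L 'a) \<Rightarrow> ('a \<Rightarrow>\<^sub>L 'a) \<Rightarrow> (real \<Rightarrow> complex) \<Rightarrow> real" where
  "r_min K A \<Gamma> = d0 A \<Gamma> * (1 - VarA K A \<Gamma>) / 2 -
     sqrt ((d0 A \<Gamma>)\<^sup>2 * (1 - VarA K A \<Gamma>)\<^sup>2 / 4 - d0 A \<Gamma> * VarA K A \<Gamma> * norm A)"

definition omega ::
  "(complex \<Rightarrow> 'a::complex_hilbert \<Rightarrow>\<^sub>L 'a) \<Rightarrow> ('a \<Rightarrow>\<^sub>L 'a) \<Rightarrow> (real \<Rightarrow> complex) \<Rightarrow> real" where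
  "omega K A \<Gamma> = d0 A \<Gamma> * (1 - VarA K A \<Gamma>)\<^sup>2 - 4 * norm A * VarA K A \<Gamma>"

definition r0 ::
  "real \<Rightarrow> complex set \<Rightarrow> (complex \<Rightarrow> 'a::complex_hilbert \<Rightarrow>\<^sub>L 'a) \<Rightarrow> ('a \<Rightarrow>\<^sub>L 'a) \<Rightarrow> real" where
  "r0 \<alpha> D K A = Inf {r_min K A \<Gamma> | \<Gamma>. is_contour \<alpha> D \<Gamma> \<and> K_bounded K \<Gamma> \<and>
     0 < d0 A \<Gamma> \<and> VarA K A \<Gamma> < 1 \<and> 0 < omega K A \<Gamma>}"

definition V1 ::
  "(complex \<Rightarrow> 'a::complex_hilbert \<Rightarrow>\<^sub>L 'a) \<Rightarrow> ('a \<Rightarrow>\<^sub>L 'a) \<Rightarrow> (real \<Rightarrow> complex) \<Rightarrow> 'a \<Rightarrow>\<^sub>L 'a" where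
  "V1 K Y \<Gamma> = op_contour_integral \<Gamma> (\<lambda>\<mu>. K \<mu> o\<^sub>L Y o\<^sub>L resolvent Y \<mu>)"

definition M1 ::
  "(complex \<Rightarrow> 'a::complex_hilbert \<Rightarrow>\<^sub>L 'a) \<Rightarrow> ('a \<Rightarrow>\<^sub>L 'a) \<Rightarrow> (real \<Rightarrow> complex) \<Rightarrow>
     complex \<Rightarrow> 'a \<Rightarrow>\<^sub>L 'a" where
  "M1 K A \<Gamma> z =
     A - scalar_op z + op_contour_integral \<Gamma> (\<lambda>\<mu>. (z / (z - \<mu>)) \<cdot>\<^sub>C K \<mu>)"

definition W1 ::
  "(complex \<Rightarrow> 'a::complex_hilbert \<Rightarrow>\<^sub>L 'a) \<Rightarrow> ('a \<Rightarrow>\<^sub>L 'a) \<Rightarrow> (real \<Rightarrow> complex) \<Rightarrow>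
     complex \<Rightarrow> 'a \<Rightarrow>\<^sub>L 'a" where
  "W1 K H \<Gamma> z =
     id_blinfun - op_contour_integral \<Gamma> (\<lambda>\<mu>. K \<mu> o\<^sub>L resolvent H \<mu>)
     + z \<cdot>\<^sub>C op_contour_integral \<Gamma> (\<lambda>\<mu>. inverse (z - \<mu>) \<cdot>\<^sub>C (K \<mu> o\<^sub>L resolvent H \<mu>))"

end

theory Submission
  imports Defs
begin

text \<open>
  Put \<open>H = A + X\<close>, where \<open>A\<close> denotes the selfadjoint operator \<open>A\<^sub>1 - B\<^sub>1\<^sub>0 B\<^sub>0\<^sub>1\<close>, \<open>R(\<mu>) = (H - \<mu>)\<^sup>-\<^sup>1\<close>,
  \<open>d = d\<^sub>0(\<Gamma>)\<close>, \<open>V = Var(B, \<Gamma>)\<close> and \<open>\<delta>(\<mu>) = dist(\<mu>, \<sigma>(A)) \<ge> d\<close> for \<open>\<mu>\<close> on the contour.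

  The factorization is an identity between integrands. From \<open>R(\<mu>) (H - z) = I + (\<mu> - z) R(\<mu>)\<close> and
  \<open>H R(\<mu>) = I + \<mu> R(\<mu>)\<close> it follows that
  \<open>K H R(\<mu>) = z / (z - \<mu>) K + K R(\<mu>) (H - z) - z / (z - \<mu>) K R(\<mu>) (H - z)\<close>
  (\<open>factorization_integrand\<close>); integrating and inserting \<open>X = \<integral> K H R\<close> gives
  \<open>M\<^sub>1(z) = W\<^sub>1(z) (H - z)\<close>.

  For the bound, \<open>W\<^sub>1(z) = I + \<integral> \<mu> / (z - \<mu>) K R(\<mu>) d\<mu>\<close>. The hypotheses give
  \<open>\<parallel>X\<parallel> \<le> r\<^sub>0 \<le> r\<^sub>m\<^sub>i\<^sub>n < d (1 - V) / 2\<close>, hence \<open>\<parallel>R(\<mu>)\<parallel> \<le> 1 / (\<delta> - \<parallel>X\<parallel>) \<le> 2 / (\<delta> (1 + V))\<close>, because \<open>A\<close> is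
  selfadjoint. If \<open>dist(z, \<sigma>(A)) \<le> d (1 - V) / 2\<close> then likewise \<open>\<bar>z - \<mu>\<bar> \<ge> \<delta> (1 + V) / 2\<close>, while
  \<open>\<bar>\<mu>\<bar> \<le> \<delta> + \<parallel>A\<parallel>\<close>. So the integrand is at most \<open>4 (d + \<parallel>A\<parallel>) / (d (1 + V)\<^sup>2)\<close> times \<open>\<parallel>K\<parallel> / \<delta>\<close>, whose
  integral is \<open>V\<close>. Hence \<open>W\<^sub>1(z) - I\<close> has norm at most \<open>4 V (d + \<parallel>A\<parallel>) / (d (1 + V)\<^sup>2)\<close>, and this number is
  less than 1 because \<open>4 V \<parallel>A\<parallel> < d (1 - V)\<^sup>2\<close> and \<open>(1 + V)\<^sup>2 = (1 - V)\<^sup>2 + 4 V\<close>.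

  Two general facts carry the argument. The estimate \<open>\<parallel>(A - \<mu>) x\<parallel> \<ge> dist(\<mu>, \<sigma>(A)) \<parallel>x\<parallel>\<close> for selfadjoint
  \<open>A\<close> (\<open>selfadjoint_lower_bound\<close>) is derived without the spectral theorem. The integrals converge in
  the operator norm in the Henstock-Kurzweil sense, by an approximation argument in
  \<open>L\<^sup>1\<close> (\<open>integrable_on_L1_approx\<close>).
\<close>

section \<open>Scalar multiplication of vectors and operators\<close>

lemma scalar_op_apply [simp]: "blinfun_apply (scalar_op a) x = a *\<^sub>C x"
  by (simp add: scalar_op.rep_eq)

lemma scale_op_apply [simp]: "blinfun_apply (a \<cdot>\<^sub>C T) x = a *\<^sub>C blinfun_apply T x"
  by (simp add: scale_op_def)

lemma scaleC_scaleR: "a *\<^sub>C (r *\<^sub>R x) = r *\<^sub>R (a *\<^sub>C (x :: 'a::complex_hilbert))"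
  by (metis mult.commute scaleC_of_real scaleC_scaleC)

lemma scaleR_scaleC: "(r *\<^sub>R a) *\<^sub>C x = r *\<^sub>R (a *\<^sub>C (x :: 'a::complex_hilbert))"
  by (metis scaleC_of_real scaleC_scaleC scaleR_conv_of_real)

lemma scaleC_one [simp]: "1 *\<^sub>C x = (x :: 'a::complex_hilbert)"
  by (metis of_real_1 scaleC_of_real scaleR_one)

lemma scaleC_zero_left [simp]: "0 *\<^sub>C x = (0 :: 'a::complex_hilbert)"
  by (metis of_real_0 scaleC_of_real scaleR_zero_left)

lemma scaleC_minus_left: "(- a) *\<^sub>C x = - (a *\<^sub>C (x :: 'a::complex_hilbert))"
  by (metis add.right_inverse eq_neg_iff_add_eq_0 scaleC_add_left scaleC_zero_left add.commute)

lemma scaleC_diff_left: "(a - b) *\<^sub>C x = a *\<^sub>C x - b *\<^sub>C (x :: 'a::complex_hilbert)"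
  by (metis add_uminus_conv_diff scaleC_add_left scaleC_minus_left)

lemma scaleC_diff_right: "a *\<^sub>C (x - y) = a *\<^sub>C x - a *\<^sub>C (y :: 'a::complex_hilbert)"
  using bounded_linear_scaleC[of a] by (rule linear_simps)

lemmas scaleC_simps = scaleC_add_left scaleC_add_right scaleC_diff_left scaleC_diff_right
  scaleC_minus_left scaleC_scaleC

lemma norm_scale_op_le:
  fixes T :: "'a::real_normed_vector \<Rightarrow>\<^sub>L 'b::complex_hilbert"
  shows "norm (a \<cdot>\<^sub>C T) \<le> cmod a * norm T"
proof (rule norm_blinfun_bound)
  fix x
  show "norm (blinfun_apply (a \<cdot>\<^sub>C T) x) \<le> cmod a * norm T * norm x"
    using mult_left_mono[OF norm_blinfun[of T x], of "cmod a"] by (simp add: norm_scaleC mult.assoc)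
qed simp

lemma bounded_bilinear_scale_op:
  "bounded_bilinear (scale_op :: complex \<Rightarrow> ('a::real_normed_vector \<Rightarrow>\<^sub>L 'b::complex_hilbert) \<Rightarrow> _)"
proof
  show "\<exists>B. \<forall>a (T :: 'a \<Rightarrow>\<^sub>L 'b). norm (a \<cdot>\<^sub>C T) \<le> norm a * norm T * B"
    by (rule exI[of _ 1]) (simp add: norm_scale_op_le)
qed (auto intro!: blinfun_eqI simp: blinfun.bilinear_simps scaleC_simps scaleC_scaleR scaleR_scaleC)

lemma norm_scalar_op_le: "norm (scalar_op a :: 'a::complex_hilbert \<Rightarrow>\<^sub>L 'a) \<le> cmod a"
  by (rule norm_blinfun_bound) (simp_all add: norm_scaleC)

section \<open>Inverses of bounded operators\<close>

lemma op_inverse_eq: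
  assumes "is_inverse T S"
  shows "op_inverse T = S"
  unfolding op_inverse_def
proof (rule the_equality)
  fix S' assume "is_inverse T S'"
  then show "S' = S"
    using assms unfolding is_inverse_def
    by (intro blinfun_eqI) (metis blinfun_apply_blinfun_compose blinfun_apply_id_blinfun)
qed (fact assms)

lemma is_inverse_op_inverse: "op_invertible T \<Longrightarrow> is_inverse T (op_inverse T)"
  unfolding op_invertible_def using op_inverse_eq by blast

lemma is_inverse_apply:
  assumes "is_inverse T S"
  shows "blinfun_apply T (blinfun_apply S x) = x" "blinfun_apply S (blinfun_apply T x) = x"
  using assms unfolding is_inverse_def
  by (metis blinfun_apply_blinfun_compose blinfun_apply_id_blinfun)+

lemma is_inverseI:
  assumes "\<And>x. blinfun_apply T (blinfun_apply S x) = x" "\<And>x. blinfun_apply S (blinfun_apply T x) = x"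
  shows "is_inverse T S"
  unfolding is_inverse_def using assms by (auto intro!: blinfun_eqI)

text \<open>
  Instead of summing the Neumann series, \<open>S = I + T S\<close> and \<open>S = I + S T\<close> are solved as fixed point
  equations; the two solutions agree.
\<close>

lemma neumann_inverse:
  fixes T :: "'a::banach \<Rightarrow>\<^sub>L 'a"
  assumes T: "norm T \<le> q" and q: "q < 1"
  obtains S where "is_inverse (id_blinfun - T) S" "norm S \<le> inverse (1 - q)"
proof -
  have q0: "0 \<le> q" using T norm_ge_zero order_trans by blast
  have l: "norm (T o\<^sub>L W) \<le> q * norm W" for W :: "'a \<Rightarrow>\<^sub>L 'a"
    using norm_blinfun_compose[of T W] mult_right_mono[OF T, of "norm W"] by simp
  have r: "norm (W o\<^sub>L T) \<le> q * norm W" for W :: "'a \<Rightarrow>\<^sub>L 'a"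
    using norm_blinfun_compose[of W T] mult_left_mono[OF T, of "norm W"] by (simp add: mult.commute)
  have "\<exists>!S. id_blinfun + (T o\<^sub>L S) = S"
    using l q0 q
    by (intro banach_fix_type[of q]) (auto simp: dist_norm
        bounded_bilinear.diff_right[OF bounded_bilinear_blinfun_compose, symmetric])
  then obtain S where S: "id_blinfun + (T o\<^sub>L S) = S" by blast
  have "\<exists>!S. id_blinfun + (S o\<^sub>L T) = S"
    using r q0 q
    by (intro banach_fix_type[of q]) (auto simp: dist_norm
        bounded_bilinear.diff_left[OF bounded_bilinear_blinfun_compose, symmetric])
  then obtain S' where S': "id_blinfun + (S' o\<^sub>L T) = S'" by blast
  have a: "S x = x + T (S x)" for x
    using arg_cong[OF S, of "\<lambda>U. blinfun_apply U x"] by (simp add: blinfun.bilinear_simps)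
  have b: "S' x = x + S' (T x)" for x
    using arg_cong[OF S', of "\<lambda>U. blinfun_apply U x"] by (simp add: blinfun.bilinear_simps)
  have eq: "S' x = S x" for x
    using a[of x] b[of "S x"] by (metis add_right_cancel blinfun.add_right)
  have "is_inverse (id_blinfun - T) S"
  proof (rule is_inverseI)
    show "blinfun_apply (id_blinfun - T) (blinfun_apply S x) = x" for x
      using a[of x] by (simp add: blinfun.bilinear_simps diff_eq_eq)
    show "blinfun_apply S (blinfun_apply (id_blinfun - T) x) = x" for x
      using b[of x] by (simp add: blinfun.bilinear_simps diff_eq_eq eq)
  qed
  moreover have "norm (id_blinfun + (T o\<^sub>L S)) \<le> 1 + q * norm S"
    by (rule norm_triangle_le, rule add_mono[OF norm_blinfun_id_le l])
  then have "norm S \<le> inverse (1 - q)"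
    using q unfolding S by (simp add: field_simps)
  ultimately show ?thesis using that by blast
qed

lemma perturbed_inverse:
  fixes T E :: "'a::banach \<Rightarrow>\<^sub>L 'a"
  assumes TS: "is_inverse T S" and S: "norm S \<le> s" and E: "norm E \<le> e" and small: "s * e < 1"
  obtains R where "is_inverse (T + E) R" "norm R \<le> s / (1 - s * e)"
proof -
  have s0: "0 \<le> s" using S norm_ge_zero order_trans by blast
  have "norm (- (S o\<^sub>L E)) \<le> s * e"
    using norm_blinfun_compose[of S E] mult_mono[OF S E s0 norm_ge_zero] by simp
  then obtain U where U: "is_inverse (id_blinfun - (- (S o\<^sub>L E))) U" "norm U \<le> inverse (1 - s * e)"
    using small by (rule neumann_inverse)
  have u1: "U x + S (E (U x)) = x" and u2: "U (x + S (E x)) = x" for x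
    using is_inverse_apply[OF U(1), of x] by (simp_all add: blinfun.bilinear_simps)
  have "is_inverse (T + E) (U o\<^sub>L S)"
  proof (rule is_inverseI)
    fix x
    have "T (U (S x) + S (E (U (S x)))) = x"
      by (simp add: u1 is_inverse_apply[OF TS])
    then show "blinfun_apply (T + E) (blinfun_apply (U o\<^sub>L S) x) = x"
      by (simp add: blinfun.bilinear_simps is_inverse_apply[OF TS])
    show "blinfun_apply (U o\<^sub>L S) (blinfun_apply (T + E) x) = x"
      using u2[of x] by (simp add: blinfun.bilinear_simps is_inverse_apply[OF TS])
  qed
  moreover have "norm (U o\<^sub>L S) \<le> inverse (1 - s * e) * s"
    by (rule order_trans[OF norm_blinfun_compose mult_mono[OF U(2) S]]) (use small in simp_all)
  ultimately show ?thesis using that by (simp add: divide_inverse mult.commute)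
qed

lemma is_inverse_compose:
  assumes "is_inverse T S" "is_inverse T' S'"
  shows "is_inverse (T o\<^sub>L T') (S' o\<^sub>L S)"
  by (rule is_inverseI) (simp_all add: is_inverse_apply[OF assms(1)] is_inverse_apply[OF assms(2)])

text \<open>The resolvent identity gives continuity, once the inverses are uniformly bounded.\<close>

lemma continuous_on_inverse:
  fixes T R :: "'b::metric_space \<Rightarrow> 'a::real_normed_vector \<Rightarrow>\<^sub>L 'a"
  assumes T: "continuous_on S T" and R: "\<And>t. t \<in> S \<Longrightarrow> is_inverse (T t) (R t)"
    and c: "\<And>t. t \<in> S \<Longrightarrow> norm (R t) \<le> c"
  shows "continuous_on S R"
  unfolding continuous_on_def
proof (intro ballI)
  fix t assume t: "t \<in> S"
  have b: "norm (R s - R t) \<le> c * norm (T s - T t) * c" if s: "s \<in> S" for s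
  proof -
    have c0: "0 \<le> c" using c[OF t] norm_ge_zero order_trans by blast
    have "R s - R t = R s o\<^sub>L (T t - T s) o\<^sub>L R t"
      by (rule blinfun_eqI)
        (simp add: blinfun.bilinear_simps is_inverse_apply[OF R[OF s]] is_inverse_apply[OF R[OF t]])
    also have "norm \<dots> \<le> norm (R s) * norm (T t - T s) * norm (R t)"
      by (meson norm_blinfun_compose order_trans mult_right_mono norm_ge_zero)
    also have "\<dots> \<le> c * norm (T t - T s) * c"
      using c[OF s] c[OF t] c0 by (intro mult_mono) auto
    finally show ?thesis by (simp add: norm_minus_commute)
  qed
  have "(T \<longlongrightarrow> T t) (at t within S)"
    using T t unfolding continuous_on_def by blast
  then have "((\<lambda>s. c * norm (T s - T t) * c) \<longlongrightarrow> 0) (at t within S)"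
    by (auto intro!: tendsto_eq_intros)
  then have "((\<lambda>s. R s - R t) \<longlongrightarrow> 0) (at t within S)"
    by (rule Lim_null_comparison[rotated]) (use b in \<open>simp add: eventually_at_filter\<close>)
  then show "(R \<longlongrightarrow> R t) (at t within S)"
    by (rule LIM_zero_cancel)
qed

section \<open>Adjoints and complex linearity\<close>

lemma cinner_eqI:
  assumes "\<And>y. cinner u y = cinner v y"
  shows "u = v"
proof -
  have "inner (u - v) (u - v) = 0"
    using assms[of "u - v"] by (metis Re_cinner inner_diff_left right_minus_eq)
  then show ?thesis by simp
qed

lemma is_adjoint_sym: "is_adjoint T S \<Longrightarrow> is_adjoint S T"
  unfolding is_adjoint_def by (metis cinner_commute)

lemma is_adjoint_imp_complex_linear:
  assumes "is_adjoint T S"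
  shows "complex_linear T"
  unfolding complex_linear_def
proof (intro allI cinner_eqI)
  fix a x y
  show "cinner (T (a *\<^sub>C x)) y = cinner (a *\<^sub>C T x) y"
    using assms unfolding is_adjoint_def by (simp add: cinner_scaleC_left)
qed

lemma is_adjoint_inner: "is_adjoint T S \<Longrightarrow> inner (T x) y = inner x (S y)"
  unfolding is_adjoint_def by (metis Re_cinner)

lemma norm_adjoint_diff_le:
  assumes "is_adjoint T S" "is_adjoint T' S'"
  shows "norm (S - S') \<le> norm (T - T')"
proof (rule norm_blinfun_bound)
  fix y
  define x where "x = (S - S') y"
  have "norm x * norm x = inner ((T - T') x) y"
    using is_adjoint_inner[OF assms(1), of x y] is_adjoint_inner[OF assms(2), of x y]
    by (simp add: blinfun.bilinear_simps inner_diff_left inner_diff_right x_def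
        flip: power2_eq_square power2_norm_eq_inner)
      (simp add: power2_norm_eq_inner inner_diff_left inner_diff_right)
  also have "\<dots> \<le> norm ((T - T') x) * norm y" by (rule norm_cauchy_schwarz)
  also have "\<dots> \<le> (norm (T - T') * norm x) * norm y"
    by (rule mult_right_mono[OF norm_blinfun norm_ge_zero])
  finally have "norm x * norm x \<le> norm x * (norm (T - T') * norm y)" by (simp add: mult_ac)
  then show "norm (blinfun_apply (S - S') y) \<le> norm (T - T') * norm y"
    unfolding x_def[symmetric] by (cases "x = 0") simp_all
qed simp

lemma complex_linear_iff: "complex_linear T \<longleftrightarrow> (\<forall>a. T o\<^sub>L scalar_op a = a \<cdot>\<^sub>C T)"
  unfolding complex_linear_def
  by (metis blinfun_apply_blinfun_compose blinfun_eqI scalar_op_apply scale_op_apply)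

lemma complex_linear_compose:
  "complex_linear T \<Longrightarrow> complex_linear S \<Longrightarrow> complex_linear (T o\<^sub>L S)"
  by (simp add: complex_linear_def)

lemma complex_linear_scale: "complex_linear T \<Longrightarrow> complex_linear (z \<cdot>\<^sub>C T)"
  by (simp add: complex_linear_def scaleC_scaleC mult.commute)

lemma complex_linear_add: "complex_linear T \<Longrightarrow> complex_linear S \<Longrightarrow> complex_linear (T + S)"
  by (simp add: complex_linear_def blinfun.bilinear_simps scaleC_add_right)

lemma complex_linear_diff: "complex_linear T \<Longrightarrow> complex_linear S \<Longrightarrow> complex_linear (T - S)"
  by (simp add: complex_linear_def blinfun.bilinear_simps scaleC_diff_right)

lemma complex_linear_id: "complex_linear id_blinfun"
  by (simp add: complex_linear_def)

lemma complex_linear_scalar_op: "complex_linear (scalar_op z)"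
  by (simp add: complex_linear_def scaleC_scaleC mult.commute)

lemma complex_linear_inverse:
  assumes "complex_linear T" "is_inverse T S"
  shows "complex_linear S"
  using assms(1) is_inverse_apply[OF assms(2)] unfolding complex_linear_def by metis

section \<open>Resolvents of bounded selfadjoint operators\<close>

text \<open>For \<open>\<parallel>A\<parallel> < \<bar>z\<bar>\<close> the operator \<open>A - z\<close> is a small perturbation of \<open>- z I\<close>.\<close>

lemma spectrum_bound:
  assumes "z \<in> op_spectrum A"
  shows "cmod z \<le> norm A"
proof (rule ccontr)
  assume "\<not> cmod z \<le> norm A"
  then have z: "norm A < cmod z" by simp
  then have z0: "z \<noteq> 0" by auto
  have "is_inverse (scalar_op (- z) :: 'a \<Rightarrow>\<^sub>L 'a) (scalar_op (- inverse z))"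
    using z0 by (intro is_inverseI) (simp_all add: scaleC_scaleC)
  moreover have "norm (scalar_op (- inverse z) :: 'a \<Rightarrow>\<^sub>L 'a) \<le> inverse (cmod z)"
    using norm_scalar_op_le[of "- inverse z", where 'a='a] by (simp add: norm_inverse)
  moreover have "inverse (cmod z) * norm A < 1"
    using z z0 by (simp add: field_simps)
  ultimately obtain R where "is_inverse (scalar_op (- z) + A) R"
    using perturbed_inverse by blast
  moreover have "scalar_op (- z) + A = A - scalar_op z"
    by (rule blinfun_eqI) (simp add: blinfun.bilinear_simps scaleC_minus_left)
  ultimately show False
    using assms unfolding op_spectrum_def op_invertible_def by auto
qed

text \<open>
  For a symmetric \<open>M\<close> with nonnegative form, \<open>\<parallel>M x\<parallel>\<^sup>2 \<le> (\<parallel>M\<parallel> + 1) \<langle>M x, x\<rangle>\<close>, and an inverse of \<open>M\<close> bounds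
  \<open>\<parallel>x\<parallel>\<close> by a multiple of \<open>\<parallel>M x\<parallel>\<close>. So if the form has infimum zero on the unit sphere, \<open>M\<close> is not
  invertible.
\<close>

lemma positive_invertible_imp_coercive:
  fixes M :: "'a::real_inner \<Rightarrow>\<^sub>L 'a"
  assumes sym: "\<And>x y. inner (M x) y = inner x (M y)" and pos: "\<And>x. 0 \<le> inner (M x) x"
    and inv: "op_invertible M"
  obtains c where "0 < c" "\<And>x. c * (norm x)\<^sup>2 \<le> inner (M x) x"
proof -
  obtain S where S: "is_inverse M S" using inv unfolding op_invertible_def by blast
  define m where "m = norm M + 1"
  have m: "0 < m" by (simp add: m_def add_nonneg_pos)
  \<comment> \<open>From \<open>\<langle>M u, u\<rangle> \<ge> 0\<close> at \<open>u = m x - M x\<close>, in place of the Cauchy-Schwarz inequality for the form.\<close>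
  have key: "(norm (M x))\<^sup>2 \<le> m * inner (M x) x" for x
  proof -
    define y where "y = M x"
    have "0 \<le> inner (M (m *\<^sub>R x - y)) (m *\<^sub>R x - y)" by (rule pos)
    also have "\<dots> = m\<^sup>2 * inner y x - 2 * m * inner y y + inner (M y) y"
      using sym[of y x]
      by (simp add: blinfun.bilinear_simps inner_diff_left inner_diff_right y_def power2_eq_square
          algebra_simps inner_commute)
    also have "inner (M y) y \<le> norm (M y) * norm y" by (rule norm_cauchy_schwarz)
    also have "norm (M y) * norm y \<le> (norm M * norm y) * norm y"
      by (rule mult_right_mono[OF norm_blinfun norm_ge_zero])
    also have "\<dots> \<le> m * inner y y"
      by (simp add: m_def power2_norm_eq_inner[symmetric] power2_eq_square algebra_simps)
    finally have "m * (m * inner y x - inner y y) \<ge> 0"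
      by (simp add: power2_eq_square algebra_simps)
    then have "inner y y \<le> m * inner y x"
      using m by (simp add: zero_le_mult_iff)
    then show ?thesis by (simp add: y_def power2_norm_eq_inner)
  qed
  define c where "c = 1 / (m * ((norm S)\<^sup>2 + 1))"
  have p: "0 < (norm S)\<^sup>2 + 1" by (simp add: add_nonneg_pos)
  have "c * (norm x)\<^sup>2 \<le> inner (M x) x" for x
  proof -
    have "norm x \<le> norm S * norm (M x)"
      using norm_blinfun[of S "M x"] by (simp add: is_inverse_apply[OF S])
    then have "(norm x)\<^sup>2 \<le> (norm S)\<^sup>2 * (norm (M x))\<^sup>2"
      by (metis norm_ge_zero power_mono power_mult_distrib)
    also have "\<dots> \<le> ((norm S)\<^sup>2 + 1) * (m * inner (M x) x)"
      using key by (intro mult_mono) auto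
    finally have "(norm x)\<^sup>2 \<le> (m * ((norm S)\<^sup>2 + 1)) * inner (M x) x" by (simp only: mult_ac)
    then show ?thesis using m p by (simp add: c_def pos_divide_le_eq mult.commute del: distrib_left distrib_right)
  qed
  moreover have "0 < c" using m p by (simp add: c_def)
  ultimately show ?thesis using that by blast
qed

text \<open>
  With \<open>b = Re \<mu>\<close> and \<open>P = A - b\<close>, let \<open>s\<close> be the infimum of \<open>\<parallel>P x\<parallel>\<^sup>2\<close> over the unit sphere.
  Then \<open>P\<^sup>2 - s = (P - \<surd>s) (P + \<surd>s)\<close> is not invertible, so one of the numbers \<open>b \<plusminus> \<surd>s\<close>, both of which
  have distance \<open>\<surd>(s + (Im \<mu>)\<^sup>2)\<close> to \<open>\<mu>\<close>, is in the spectrum, while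
  \<open>\<parallel>(A - \<mu>) x\<parallel>\<^sup>2 = \<parallel>P x\<parallel>\<^sup>2 + (Im \<mu>)\<^sup>2 \<parallel>x\<parallel>\<^sup>2\<close>.
\<close>

lemma selfadjoint_lower_bound:
  fixes A :: "'a::complex_hilbert \<Rightarrow>\<^sub>L 'a"
  assumes A: "is_adjoint A A"
  shows "infdist \<mu> (op_spectrum A) * norm x \<le> norm ((A - scalar_op \<mu>) x)"
proof (cases "x = 0")
  case False
  define b c where "b = Re \<mu>" and "c = Im \<mu>"
  define P where "P = A - scalar_op (of_real b)"
  have P_ap: "P u = A u - b *\<^sub>R u" for u
    by (simp add: P_def blinfun.bilinear_simps scaleC_of_real)
  have Psym: "inner (P u) v = inner u (P v)" for u v
    using is_adjoint_inner[OF A, of u v] by (simp add: P_ap inner_diff_left inner_diff_right)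
  define Q where "Q = (\<lambda>u. (norm (P u))\<^sup>2) ` sphere 0 1"
  define s where "s = Inf Q"
  have "x /\<^sub>R norm x \<in> sphere 0 1" using False by simp
  then have Qne: "Q \<noteq> {}" unfolding Q_def by blast
  have bdd: "bdd_below Q" by (rule bdd_belowI[of _ 0]) (auto simp: Q_def)
  have s0: "0 \<le> s" unfolding s_def by (rule cInf_greatest[OF Qne]) (auto simp: Q_def)
  have lower: "r * (norm u)\<^sup>2 \<le> (norm (P u))\<^sup>2" if r: "\<And>q. q \<in> Q \<Longrightarrow> r \<le> q" for r u
  proof (cases "u = 0")
    case False
    have "r \<le> (norm (P (u /\<^sub>R norm u)))\<^sup>2"
      by (rule r) (use False in \<open>simp add: Q_def\<close>)
    then show ?thesis using False by (simp add: blinfun.bilinear_simps power_mult_distrib field_simps)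
  qed simp
  have low_s: "s * (norm u)\<^sup>2 \<le> (norm (P u))\<^sup>2" for u
    by (rule lower) (simp add: s_def cInf_lower[OF _ bdd])
  define M where "M = (P o\<^sub>L P) - s *\<^sub>R id_blinfun"
  have M_ap: "M u = P (P u) - s *\<^sub>R u" for u
    by (simp add: M_def blinfun.bilinear_simps)
  have M_form: "inner (M u) u = (norm (P u))\<^sup>2 - s * (norm u)\<^sup>2" for u
    by (simp add: M_ap inner_diff_left power2_norm_eq_inner Psym)
  have not_inv: "\<not> op_invertible M"
  proof
    assume "op_invertible M"
    then obtain k where k: "0 < k" "\<And>u. k * (norm u)\<^sup>2 \<le> inner (M u) u"
      by (rule positive_invertible_imp_coercive[rotated 2])
        (simp_all add: M_form low_s, simp add: M_ap inner_diff_left inner_diff_right Psym)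
    have "s + k \<le> s"
      unfolding s_def
    proof (rule cInf_greatest[OF Qne])
      fix q assume "q \<in> Q"
      then obtain u where u: "norm u = 1" "q = (norm (P u))\<^sup>2" by (auto simp: Q_def)
      show "Inf Q + k \<le> q" using k(2)[of u] by (simp add: M_form u s_def)
    qed
    then show False using k(1) by simp
  qed
  obtain \<nu> where \<nu>: "\<nu> \<in> op_spectrum A" "(cmod (\<mu> - \<nu>))\<^sup>2 = s + c\<^sup>2"
  proof -
    define p m where "p = complex_of_real (b + sqrt s)" and "m = complex_of_real (b - sqrt s)"
    have "p \<in> op_spectrum A \<or> m \<in> op_spectrum A"
    proof (rule ccontr)
      assume "\<not> (p \<in> op_spectrum A \<or> m \<in> op_spectrum A)"
      then obtain S1 S2 where "is_inverse (A - scalar_op p) S1" "is_inverse (A - scalar_op m) S2"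
        unfolding op_spectrum_def op_invertible_def by auto
      then have "is_inverse ((A - scalar_op p) o\<^sub>L (A - scalar_op m)) (S2 o\<^sub>L S1)"
        by (rule is_inverse_compose)
      moreover have "(A - scalar_op p) o\<^sub>L (A - scalar_op m) = M"
      proof (rule blinfun_eqI)
        fix u
        have *: "sqrt s *\<^sub>R sqrt s *\<^sub>R w = s *\<^sub>R w" for w :: 'a using s0 by simp
        show "blinfun_apply ((A - scalar_op p) o\<^sub>L (A - scalar_op m)) u = M u"
          unfolding p_def m_def
          by (simp only: blinfun_apply_blinfun_compose scalar_op_apply blinfun.bilinear_simps
              scaleC_of_real P_ap M_ap scaleR_add_left scaleR_diff_left scaleR_diff_right *)
            (simp add: algebra_simps * s0)
      qed
      ultimately show False using not_inv unfolding op_invertible_def by auto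
    qed
    moreover have "(cmod (\<mu> - p))\<^sup>2 = s + c\<^sup>2" "(cmod (\<mu> - m))\<^sup>2 = s + c\<^sup>2"
      using s0 by (simp_all add: cmod_power2 p_def m_def b_def c_def)
    ultimately show ?thesis using that by blast
  qed
  have "(norm ((A - scalar_op \<mu>) x))\<^sup>2 = (norm (P x))\<^sup>2 + c\<^sup>2 * (norm x)\<^sup>2"
  proof -
    have "\<mu> = of_real b + \<i> * of_real c" by (simp add: b_def c_def complex_eq_iff)
    then have e: "(A - scalar_op \<mu>) x = P x - c *\<^sub>R (\<i> *\<^sub>C x)"
      by (simp add: P_ap blinfun.bilinear_simps scaleC_add_left scaleC_of_real
          scaleC_scaleR flip: scaleC_scaleC)
    have real: "cinner (P x) x = cnj (cinner (P x) x)"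
    proof -
      have "cinner (A x) x = cnj (cinner (A x) x)"
        using A unfolding is_adjoint_def by (metis cinner_commute)
      moreover have "cinner (P x) x = cinner (A x) x + of_real (- b) * cinner x x"
        by (simp only: P_ap cinner_scaleC_left[symmetric] cinner_add_left[symmetric] scaleC_of_real)
          simp
      moreover have "cinner x x = cnj (cinner x x)" by (rule cinner_commute)
      ultimately show ?thesis by simp
    qed
    have "cinner (P x) (\<i> *\<^sub>C x) = cnj (\<i> * cinner x (P x))"
      by (metis cinner_commute cinner_scaleC_left)
    also have "\<dots> = - \<i> * cinner (P x) x" by (simp flip: cinner_commute)
    finally have "inner (P x) (\<i> *\<^sub>C x) = 0"
      using arg_cong[OF real, of Im] by (simp flip: Re_cinner)
    then show ?thesis
      unfolding e
      by (simp add: power2_norm_eq_inner inner_diff_left inner_diff_right inner_commute)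
        (simp add: power2_eq_square norm_scaleC flip: power2_norm_eq_inner)
  qed
  also have "\<dots> \<ge> (s + c\<^sup>2) * (norm x)\<^sup>2" using low_s[of x] by (simp add: distrib_right)
  finally have "(cmod (\<mu> - \<nu>) * norm x)\<^sup>2 \<le> (norm ((A - scalar_op \<mu>) x))\<^sup>2"
    by (simp add: power_mult_distrib \<nu>)
  then have "cmod (\<mu> - \<nu>) * norm x \<le> norm ((A - scalar_op \<mu>) x)"
    by (rule power2_le_imp_le) simp
  moreover have "infdist \<mu> (op_spectrum A) * norm x \<le> cmod (\<mu> - \<nu>) * norm x"
    using infdist_le[OF \<nu>(1), of \<mu>] by (intro mult_right_mono) (simp_all add: dist_norm)
  ultimately show ?thesis by linarith
qed simp

lemma selfadjoint_resolvent:
  fixes A :: "'a::complex_hilbert \<Rightarrow>\<^sub>L 'a"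
  assumes A: "is_adjoint A A" and d: "0 < infdist \<mu> (op_spectrum A)"
  shows "is_inverse (A - scalar_op \<mu>) (resolvent A \<mu>)"
    and "norm (resolvent A \<mu>) \<le> 1 / infdist \<mu> (op_spectrum A)"
proof -
  have "\<mu> \<notin> op_spectrum A" using d by auto
  then show inv: "is_inverse (A - scalar_op \<mu>) (resolvent A \<mu>)"
    unfolding op_spectrum_def resolvent_def by (simp add: is_inverse_op_inverse)
  show "norm (resolvent A \<mu>) \<le> 1 / infdist \<mu> (op_spectrum A)"
  proof (rule norm_blinfun_bound)
    fix y
    show "norm (blinfun_apply (resolvent A \<mu>) y) \<le> 1 / infdist \<mu> (op_spectrum A) * norm y"
      using selfadjoint_lower_bound[OF A, of \<mu> "resolvent A \<mu> y"] d
      by (simp add: is_inverse_apply[OF inv] field_simps)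
  qed (use d in simp)
qed

section \<open>Integrals of operator-valued functions on the half-line\<close>

text \<open>
  Integrability follows from approximation in the \<open>L\<^sup>1\<close> sense. Nothing is assumed about separability of
  the codomain, because a space of bounded operators is usually not separable in the operator norm.
\<close>

lemma integrable_on_cbox_L1_approx:
  fixes f :: "'n::euclidean_space \<Rightarrow> 'a::banach"
  assumes "\<And>e. 0 < e \<Longrightarrow> \<exists>g h. g integrable_on cbox a b \<and> h integrable_on cbox a b \<and>
    (\<forall>x\<in>cbox a b. norm (f x - g x) \<le> h x) \<and> integral (cbox a b) h \<le> e"
  shows "f integrable_on cbox a b"
  unfolding integrable_Cauchy
proof (intro allI impI)
  fix e :: real assume e: "0 < e"
  then obtain g h where g: "g integrable_on cbox a b" and h: "h integrable_on cbox a b"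
    and le: "\<And>x. x \<in> cbox a b \<Longrightarrow> norm (f x - g x) \<le> h x" and small: "integral (cbox a b) h \<le> e / 8"
    using assms[of "e / 8"] by auto
  obtain \<gamma>1 where \<gamma>1: "gauge \<gamma>1" and G: "\<And>p. p tagged_division_of cbox a b \<Longrightarrow> \<gamma>1 fine p \<Longrightarrow>
      norm ((\<Sum>(x,K)\<in>p. measure lborel K *\<^sub>R g x) - integral (cbox a b) g) < e / 8"
    using has_integral_integral[THEN iffD1, OF g] e unfolding has_integral
    by (metis divide_pos_pos zero_less_numeral)
  obtain \<gamma>2 where \<gamma>2: "gauge \<gamma>2" and H: "\<And>p. p tagged_division_of cbox a b \<Longrightarrow> \<gamma>2 fine p \<Longrightarrow>
      norm ((\<Sum>(x,K)\<in>p. measure lborel K *\<^sub>R h x) - integral (cbox a b) h) < e / 8"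
    using has_integral_integral[THEN iffD1, OF h] e unfolding has_integral
    by (metis divide_pos_pos zero_less_numeral)
  define I where "I = integral (cbox a b) g"
  have bound: "norm ((\<Sum>(x,K)\<in>p. measure lborel K *\<^sub>R f x) - I) < 3 * e / 8"
    if p: "p tagged_division_of cbox a b" and f1: "\<gamma>1 fine p" and f2: "\<gamma>2 fine p" for p
  proof -
    have "norm ((\<Sum>(x,K)\<in>p. measure lborel K *\<^sub>R f x) - (\<Sum>(x,K)\<in>p. measure lborel K *\<^sub>R g x))
        = norm (\<Sum>(x,K)\<in>p. measure lborel K *\<^sub>R (f x - g x))"
      by (simp add: sum_subtractf scaleR_diff_right case_prod_beta)
    also have "\<dots> \<le> (\<Sum>(x,K)\<in>p. measure lborel K *\<^sub>R h x)"
    proof (rule sum_norm_le)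
      fix y assume y: "y \<in> p"
      then have "fst y \<in> cbox a b"
        using tag_in_interval[OF p, of "fst y" "snd y"] by simp
      then show "norm (case y of (x, K) \<Rightarrow> measure lborel K *\<^sub>R (f x - g x)) \<le> (case y of (x, K) \<Rightarrow> measure lborel K *\<^sub>R h x)"
        using le by (auto simp: case_prod_beta intro!: mult_left_mono)
    qed
    also have "\<dots> < e / 8 + e / 8"
      using H[OF p f2] small abs_ge_self unfolding real_norm_def by (smt (verit))
    finally have "norm ((\<Sum>(x,K)\<in>p. measure lborel K *\<^sub>R f x) - (\<Sum>(x,K)\<in>p. measure lborel K *\<^sub>R g x)) < e / 8 + e / 8" .
    moreover have "norm ((\<Sum>(x,K)\<in>p. measure lborel K *\<^sub>R g x) - I) < e / 8"
      using G[OF p f1] by (simp add: I_def)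
    ultimately show ?thesis
      using norm_triangle_ineq[of "(\<Sum>(x,K)\<in>p. measure lborel K *\<^sub>R f x) - (\<Sum>(x,K)\<in>p. measure lborel K *\<^sub>R g x)"
          "(\<Sum>(x,K)\<in>p. measure lborel K *\<^sub>R g x) - I"]
      by simp
  qed
  show "\<exists>\<gamma>. gauge \<gamma> \<and>
          (\<forall>\<D>1 \<D>2. \<D>1 tagged_division_of (cbox a b) \<and> \<gamma> fine \<D>1 \<and>
            \<D>2 tagged_division_of (cbox a b) \<and> \<gamma> fine \<D>2 \<longrightarrow>
            norm ((\<Sum>(x,K)\<in>\<D>1. measure lborel K *\<^sub>R f x) - (\<Sum>(x,K)\<in>\<D>2. measure lborel K *\<^sub>R f x)) < e)"
  proof (intro exI conjI allI impI)
    show "gauge (\<lambda>x. \<gamma>1 x \<inter> \<gamma>2 x)" using \<gamma>1 \<gamma>2 by (rule gauge_Int)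
    fix p q
    assume "p tagged_division_of (cbox a b) \<and> (\<lambda>x. \<gamma>1 x \<inter> \<gamma>2 x) fine p \<and>
            q tagged_division_of (cbox a b) \<and> (\<lambda>x. \<gamma>1 x \<inter> \<gamma>2 x) fine q"
    then have "norm ((\<Sum>(x,K)\<in>p. measure lborel K *\<^sub>R f x) - I) < 3 * e / 8"
      "norm ((\<Sum>(x,K)\<in>q. measure lborel K *\<^sub>R f x) - I) < 3 * e / 8"
      unfolding fine_Int by (blast intro!: bound)+
    then show "norm ((\<Sum>(x,K)\<in>p. measure lborel K *\<^sub>R f x) - (\<Sum>(x,K)\<in>q. measure lborel K *\<^sub>R f x)) < e"
      using norm_triangle_ineq4[of "(\<Sum>(x,K)\<in>p. measure lborel K *\<^sub>R f x) - I" "(\<Sum>(x,K)\<in>q. measure lborel K *\<^sub>R f x) - I"] e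
      by simp
  qed
qed

text \<open>
  The passage to an arbitrary \<open>S\<close> extends the functions by zero; the same estimate makes the
  integrals over large boxes a Cauchy family.
\<close>

lemma integrable_on_L1_approx:
  fixes f :: "'n::euclidean_space \<Rightarrow> 'a::banach"
  assumes approx: "\<And>e. 0 < e \<Longrightarrow> \<exists>g h. g integrable_on S \<and> h integrable_on S \<and>
    (\<forall>x\<in>S. norm (f x - g x) \<le> h x) \<and> integral S h \<le> e"
  shows "f integrable_on S"
proof -
  define F where "F = (\<lambda>x. if x \<in> S then f x else 0)"
  define close where "close e g h \<longleftrightarrow> g integrable_on S \<and>
      (\<forall>a b. (\<lambda>x. if x \<in> S then g x else 0) integrable_on cbox a b) \<and>
      (\<forall>a b. h integrable_on cbox a b) \<and> (\<forall>a b. integral (cbox a b) h \<le> e) \<and>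
      (\<forall>x. norm (F x - (if x \<in> S then g x else 0)) \<le> h x)" for e g h
  have main: "\<exists>g h. close e g h" if e: "0 < e" for e
  proof -
    obtain g h where g: "g integrable_on S" and h: "h integrable_on S"
      and le: "\<And>x. x \<in> S \<Longrightarrow> norm (f x - g x) \<le> h x" and small: "integral S h \<le> e"
      using approx[OF e] by blast
    define H where "H = (\<lambda>x. if x \<in> S then h x else 0)"
    have H0: "0 \<le> H x" for x
      using order_trans[OF norm_ge_zero le[of x]] by (simp add: H_def)
    have HU: "H integrable_on UNIV" "integral UNIV H \<le> e"
      using h small unfolding H_def by (simp_all add: integrable_restrict_UNIV integral_restrict_UNIV)
    have Hc: "H integrable_on cbox a b" for a b
      using h unfolding H_def by (rule integrable_altD(1))
    have "integral (cbox a b) H \<le> e" for a b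
      using integral_subset_le[OF subset_UNIV Hc HU(1)] H0 HU(2) by (meson order_trans)
    moreover have "norm (F x - (if x \<in> S then g x else 0)) \<le> H x" for x
      using le by (simp add: F_def H_def)
    ultimately have "close e g H"
      using g Hc integrable_altD(1)[OF g] unfolding close_def by (intro conjI allI)
    then show ?thesis by blast
  qed
  have Fc: "F integrable_on cbox a b" for a b
  proof (rule integrable_on_cbox_L1_approx)
    fix e :: real assume "0 < e"
    then obtain g h where "close e g h" using main by blast
    then show "\<exists>g h. g integrable_on cbox a b \<and> h integrable_on cbox a b \<and>
        (\<forall>x\<in>cbox a b. norm (F x - g x) \<le> h x) \<and> integral (cbox a b) h \<le> e"
      unfolding close_def
      by (intro exI[of _ "\<lambda>x. if x \<in> S then g x else 0"] exI[of _ h]) simp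
  qed
  have "\<exists>B>0. \<forall>a b c d. ball 0 B \<subseteq> cbox a b \<and> ball 0 B \<subseteq> cbox c d \<longrightarrow>
      norm (integral (cbox a b) F - integral (cbox c d) F) < e" if e: "0 < e" for e
  proof -
    obtain g h where gh: "close (e / 4) g h"
      using main[of "e / 4"] e by auto
    have g: "g integrable_on S"
      and gc: "(\<lambda>x. if x \<in> S then g x else 0) integrable_on cbox a b"
      and hc: "h integrable_on cbox a b" "integral (cbox a b) h \<le> e / 4"
      and le: "norm (F x - (if x \<in> S then g x else 0)) \<le> h x" for a b x
      using gh by (simp_all add: close_def)
    let ?g = "\<lambda>x. if x \<in> S then g x else 0"
    have "\<exists>B>0. \<forall>a b c d. ball 0 B \<subseteq> cbox a b \<and> ball 0 B \<subseteq> cbox c d \<longrightarrow>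
        norm (integral (cbox a b) ?g - integral (cbox c d) ?g) < e / 4"
      by (rule integrable_altD(2)[OF g]) (use e in simp)
    then obtain B where B: "0 < B" and Bd: "\<forall>a b c d. ball 0 B \<subseteq> cbox a b \<and> ball 0 B \<subseteq> cbox c d \<longrightarrow>
        norm (integral (cbox a b) ?g - integral (cbox c d) ?g) < e / 4"
      by (elim exE conjE) (rule that)
    have near: "norm (integral (cbox a b) F - integral (cbox a b) ?g) \<le> e / 4" for a b
    proof -
      have "norm (integral (cbox a b) (\<lambda>x. F x - ?g x)) \<le> integral (cbox a b) h"
        using le by (intro integral_norm_bound_integral integrable_diff Fc gc hc) auto
      then show ?thesis
        using hc(2)[of a b] by (simp add: integral_diff[OF Fc gc])
    qed
    have "norm (integral (cbox a b) F - integral (cbox c d) F) < e"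
      if "ball 0 B \<subseteq> cbox a b" "ball 0 B \<subseteq> cbox c d" for a b c d
    proof -
      define x y x' y' where "x = integral (cbox a b) F" and "y = integral (cbox c d) F"
        and "x' = integral (cbox a b) ?g" and "y' = integral (cbox c d) ?g"
      have "norm (x - y) \<le> norm (x - x') + norm (x' - y') + norm (y - y')"
        using norm_triangle_ineq4[of "(x - x') + (x' - y')" "y - y'"]
          norm_triangle_ineq[of "x - x'" "x' - y'"] by simp
      then show ?thesis
        using Bd[rule_format, OF conjI, OF that] near[of a b] near[of c d] e by (simp add: x_def y_def x'_def y'_def)
    qed
    then show ?thesis using B by blast
  qed
  then show ?thesis
    using Fc unfolding integrable_alt[of f S] F_def by blast
qed

text \<open>On a compact interval \<open>G\<close> is uniformly approximated by step functions.\<close>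

lemma scale_op_integrable_on_cbox:
  fixes g :: "real \<Rightarrow> complex" and G :: "real \<Rightarrow> 'a::complex_hilbert \<Rightarrow>\<^sub>L 'a"
  assumes g: "g integrable_on cbox a b" and g1: "\<And>t. cmod (g t) \<le> 1"
    and G: "continuous_on (cbox a b) G"
  shows "(\<lambda>t. g t \<cdot>\<^sub>C G t) integrable_on cbox a b"
proof (rule integrable_uniform_limit)
  fix e :: real
  assume e: "e > 0"
  then obtain d where "0 < d" and d: "\<And>x x'. \<lbrakk>x \<in> cbox a b; x' \<in> cbox a b; dist x' x < d\<rbrakk> \<Longrightarrow> dist (G x') (G x) < e"
    using compact_uniformly_continuous[OF G compact_cbox] unfolding uniformly_continuous_on_def by metis
  obtain p where ptag: "p tagged_division_of cbox a b" and finep: "(\<lambda>x. ball x d) fine p"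
    using fine_division_exists[OF gauge_ball[OF \<open>0 < d\<close>], of a b] .
  have "\<forall>i\<in>snd ` p. \<exists>f. (\<forall>y\<in>i. norm (g y \<cdot>\<^sub>C G y - f y) \<le> e) \<and> f integrable_on i"
  proof clarify
    fix x l
    assume xl: "(x, l) \<in> p"
    have l: "l \<subseteq> cbox a b" "x \<in> l" "l \<subseteq> ball x d" "\<exists>u v. l = cbox u v"
      using tagged_division_ofD(2-4)[OF ptag xl] finep xl unfolding fine_def by auto
    show "\<exists>f. (\<forall>y\<in>snd (x, l). norm (g y \<cdot>\<^sub>C G y - f y) \<le> e) \<and> f integrable_on snd (x, l)"
      unfolding snd_conv
    proof (intro exI conjI ballI)
      have "g integrable_on l"
        using l g integrable_on_subcbox by blast
      then show "(\<lambda>y. g y \<cdot>\<^sub>C G x) integrable_on l"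
        using integrable_linear[OF _ bounded_bilinear.bounded_linear_left[OF bounded_bilinear_scale_op]]
        by (simp add: o_def)
      fix y assume y: "y \<in> l"
      then have "norm (G y - G x) < e"
        using l d[of x y] by (auto simp: dist_norm norm_minus_commute)
      then have "cmod (g y) * norm (G y - G x) \<le> 1 * e"
        using g1[of y] e by (intro mult_mono) auto
      then show "norm (g y \<cdot>\<^sub>C G y - g y \<cdot>\<^sub>C G x) \<le> e"
        using norm_scale_op_le[of "g y" "G y - G x"]
        by (simp add: bounded_bilinear.diff_right[OF bounded_bilinear_scale_op])
    qed
  qed
  from approximable_on_division[OF less_imp_le[OF e] division_of_tagged_division[OF ptag] this]
  show "\<exists>f. (\<forall>x\<in>cbox a b. norm (g x \<cdot>\<^sub>C G x - f x) \<le> e) \<and> f integrable_on cbox a b"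
    by metis
qed

lemma integral_half_line_open:
  fixes f :: "real \<Rightarrow> 'a::banach"
  shows "integral {0..} f = integral {0<..} f"
  by (rule integral_spike_set) (auto intro: negligible_subset[of "{0}"])

text \<open>
  Here \<open>G\<close> may be unbounded near 0 and need not decay at infinity, as long as it has an integrable
  majorant. Applied with \<open>g = \<Gamma>'\<close>, this is the existence of the contour integral.
\<close>

lemma scale_op_integrable_on_half_line:
  fixes g :: "real \<Rightarrow> complex" and G :: "real \<Rightarrow> 'a::complex_hilbert \<Rightarrow>\<^sub>L 'a"
  assumes g: "\<And>a b. 0 < a \<Longrightarrow> g integrable_on {a..b}" and g1: "\<And>t. cmod (g t) \<le> 1"
    and G: "continuous_on {0<..} G"
    and q: "q integrable_on {0..}" and le: "\<And>t. 0 < t \<Longrightarrow> norm (G t) \<le> q t"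
  shows "(\<lambda>t. g t \<cdot>\<^sub>C G t) integrable_on {0..}"
    and "norm (integral {0..} (\<lambda>t. g t \<cdot>\<^sub>C G t)) \<le> integral {0..} q"
proof -
  define f where "f = (\<lambda>t. g t \<cdot>\<^sub>C G t)"
  have f_le: "norm (f t) \<le> q t" if "0 < t" for t
    using norm_scale_op_le[of "g t" "G t"] mult_right_mono[OF g1[of t] norm_ge_zero[of "G t"]]
      le[OF that] by (simp add: f_def)
  have q0: "0 \<le> q t" if "0 < t" for t using f_le[OF that] norm_ge_zero order_trans by blast
  have eq: "{0::real..} = insert 0 {0<..}" by auto
  have qi: "q integrable_on {0<..}"
    using q unfolding eq by (simp add: integrable_on_insert_iff)
  define J where "J n = {1 / real (Suc n)..real n}" for n
  have J: "J n \<subseteq> {0<..}" for n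
    by (auto simp: J_def intro: less_le_trans[of 0 "1 / real (Suc n)"])
  have fJ: "f integrable_on J n" for n
    unfolding f_def J_def interval_cbox
    using g[of "1 / real (Suc n)" "real n"] g1 continuous_on_subset[OF G J[of n]]
    by (intro scale_op_integrable_on_cbox) (simp_all add: J_def)
  have qJ: "q integrable_on J n" for n
    unfolding J_def interval_cbox
    by (rule integrable_on_subcbox[OF qi]) (use J[of n] in \<open>simp add: J_def\<close>)
  \<comment> \<open>On \<open>J n\<close>, away from the possible singularity at 0, the integrand is integrable; the integral
    of \<open>q\<close> over the complement of \<open>J n\<close> tends to zero.\<close>
  define qn where "qn n t = (if t \<in> J n then q t else 0)" for n t
  have "(\<lambda>n. integral {0<..} (qn n)) \<longlonglongrightarrow> integral {0<..} q"
  proof (rule dominated_convergence(2)[where h = q])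
    show "qn n integrable_on {0<..}" for n
      unfolding qn_def using qJ J[of n] by (simp add: integrable_restrict_Int inf.absorb1)
    show "norm (qn n t) \<le> q t" if "t \<in> {0<..}" for n t
      using q0 that by (simp add: qn_def)
    show "(\<lambda>n. qn n t) \<longlonglongrightarrow> q t" if t: "t \<in> {0<..}" for t
    proof (rule tendsto_eventually)
      have "eventually (\<lambda>n. 1 / real (Suc n) < t) sequentially"
        using order_tendstoD(2)[OF LIMSEQ_inverse_real_of_nat] t by (simp add: inverse_eq_divide)
      moreover have "eventually (\<lambda>n. t \<le> real n) sequentially"
        using filterlim_real_sequentially by (simp add: filterlim_at_top)
      ultimately show "eventually (\<lambda>n. qn n t = q t) sequentially"
        by eventually_elim (simp add: qn_def J_def)
    qed
  qed (fact qi)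
  then have lim: "(\<lambda>n. integral {0<..} q - integral {0<..} (qn n)) \<longlonglongrightarrow> 0"
    by (intro tendsto_eq_intros) auto
  have "f integrable_on {0<..}"
  proof (rule integrable_on_L1_approx)
    fix e :: real assume "0 < e"
    then obtain n where n: "integral {0<..} q - integral {0<..} (qn n) < e"
      using order_tendstoD(2)[OF lim] unfolding eventually_sequentially by blast
    have qni: "qn n integrable_on {0<..}"
      unfolding qn_def using qJ J[of n] by (simp add: integrable_restrict_Int inf.absorb1)
    have "(\<lambda>t. if t \<in> J n then f t else 0) integrable_on {0<..}"
      using fJ J[of n] by (simp add: integrable_restrict_Int inf.absorb1)
    moreover have "(\<lambda>t. q t - qn n t) integrable_on {0<..}"
      using qi qni by (rule integrable_diff)
    moreover have "norm (f t - (if t \<in> J n then f t else 0)) \<le> q t - qn n t" if "t \<in> {0<..}" for t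
      using f_le[of t] that by (simp add: qn_def)
    moreover have "integral {0<..} (\<lambda>t. q t - qn n t) \<le> e"
      using n by (simp add: integral_diff[OF qi qni])
    ultimately show "\<exists>g h. g integrable_on {0<..} \<and> h integrable_on {0<..} \<and>
        (\<forall>x\<in>{0<..}. norm (f x - g x) \<le> h x) \<and> integral {0<..} h \<le> e"
      by blast
  qed
  then have fi: "f integrable_on {0..}"
    unfolding eq by (simp add: integrable_on_insert_iff)
  then show "(\<lambda>t. g t \<cdot>\<^sub>C G t) integrable_on {0..}" unfolding f_def .
  have "norm (integral {0<..} f) \<le> integral {0<..} q"
    using \<open>f integrable_on {0<..}\<close> qi by (rule integral_norm_bound_integral) (simp add: f_le)
  then show "norm (integral {0..} (\<lambda>t. g t \<cdot>\<^sub>C G t)) \<le> integral {0..} q"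
    unfolding integral_half_line_open f_def .
qed

section \<open>Contour integrals\<close>

lemma contour_continuous: "is_contour \<alpha> D \<Gamma> \<Longrightarrow> continuous_on {0..} \<Gamma>"
  unfolding is_contour_def by (blast intro: lipschitz_on_continuous_on)

text \<open>
  The velocity \<open>\<Gamma>'\<close> is almost everywhere a limit of difference quotients, which are bounded by 1, and
  is therefore integrable on compact intervals. On a null set \<open>N\<close> containing the parameters where the
  derivative fails to exist or its modulus differs from 1 it is replaced by 0, in order to have
  \<open>\<bar>g\<bar> \<le> 1\<close> everywhere.
\<close>

lemma contour_velocity:
  assumes \<Gamma>: "is_contour \<alpha> D \<Gamma>"
  obtains g N where "negligible N" "\<And>t. t \<in> {0..} - N \<Longrightarrow> vector_derivative \<Gamma> (at t) = g t"
    "\<And>t. cmod (g t) \<le> 1" "\<And>a b. 0 < a \<Longrightarrow> g integrable_on {a..b}"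
proof -
  have "AE t in lborel. 0 < t \<longrightarrow> \<Gamma> differentiable (at t) \<and> cmod (vector_derivative \<Gamma> (at t)) = 1"
    using \<Gamma> unfolding is_contour_def by blast
  then obtain N0 where N0: "N0 \<in> null_sets lborel"
    "{t. \<not> (0 < t \<longrightarrow> \<Gamma> differentiable (at t) \<and> cmod (vector_derivative \<Gamma> (at t)) = 1)} \<subseteq> N0"
    by (auto simp: eventually_ae_filter)
  define N where "N = insert 0 N0"
  have "negligible N0"
    using N0(1) by (simp add: negligible_iff_null_sets null_sets_completionI)
  then have N: "negligible N" unfolding N_def by simp
  have good: "\<Gamma> differentiable (at t)" "cmod (vector_derivative \<Gamma> (at t)) = 1" if "0 < t" "t \<notin> N" for t
    using N0(2) that by (auto simp: N_def)
  define g where "g t = (if 0 < t \<and> t \<notin> N then vector_derivative \<Gamma> (at t) else 0)" for t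
  have g1: "cmod (g t) \<le> 1" for t
    using good by (simp add: g_def)
  have lip: "cmod (\<Gamma> s - \<Gamma> t) \<le> \<bar>s - t\<bar>" if "0 \<le> s" "0 \<le> t" for s t
    using \<Gamma> that unfolding is_contour_def by (auto dest!: lipschitz_onD[of _ _ _ s t] simp: dist_norm)
  define k where "k n = inverse (real (Suc n))" for n
  have k0: "0 < k n" for n by (simp add: k_def)
  define f where "f n t = (\<Gamma> (t + k n) - \<Gamma> t) /\<^sub>R k n" for n t
  have "g integrable_on {a..b}" if a: "0 < a" for a b
  proof -
    have "g integrable_on ({a..b} - N)"
    proof (rule dominated_convergence_integrable)
      fix n
      have "continuous_on {a..b} (f n)"
        unfolding f_def using k0[of n] a
        by (intro continuous_intros continuous_on_compose2[OF contour_continuous[OF \<Gamma>]]) auto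
      then have "f n absolutely_integrable_on {a..b}"
        by (rule absolutely_integrable_continuous_real)
      then show "f n absolutely_integrable_on {a..b} - N"
        by (rule absolutely_integrable_spike_set) (auto intro: negligible_subset[OF N])
    next
      have "(\<lambda>t. 1 :: real) integrable_on {a..b}"
        by (rule integrable_continuous_real) simp
      then show "(\<lambda>t. 1 :: real) integrable_on {a..b} - N"
        by (rule integrable_spike_set) (auto intro: negligible_subset[OF N])
    next
      fix t assume t: "t \<in> {a..b} - N"
      show "norm (g t) \<le> 1" by (rule g1)
      define v where "v = vector_derivative \<Gamma> (at t)"
      have "(\<Gamma> has_vector_derivative v) (at t)"
        using good(1)[of t] t a unfolding v_def by (simp add: vector_derivative_works)
      then have "((\<lambda>h. norm (\<Gamma> (t + h) - \<Gamma> t - h *\<^sub>R v) / norm h) \<longlongrightarrow> 0) (at 0)"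
        unfolding has_vector_derivative_def has_derivative_at by blast
      moreover have "filterlim k (at 0) sequentially"
        unfolding filterlim_at k_def using LIMSEQ_inverse_real_of_nat by simp
      ultimately have "(\<lambda>n. norm (\<Gamma> (t + k n) - \<Gamma> t - k n *\<^sub>R v) / norm (k n)) \<longlonglongrightarrow> 0"
        by (rule filterlim_compose)
      moreover have "norm (\<Gamma> (t + k n) - \<Gamma> t - k n *\<^sub>R v) / norm (k n) = norm (f n t - v)" for n
      proof -
        have "f n t - v = (\<Gamma> (t + k n) - \<Gamma> t - k n *\<^sub>R v) /\<^sub>R k n"
          using k0[of n] by (simp add: f_def scaleR_diff_right)
        then show ?thesis using k0[of n] by (simp add: divide_inverse mult.commute)
      qed
      ultimately have "(\<lambda>n. norm (f n t - v)) \<longlonglongrightarrow> 0" by simp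
      then have "(\<lambda>n. f n t) \<longlonglongrightarrow> v"
        by (simp add: tendsto_norm_zero_iff LIM_zero_iff)
      then show "(\<lambda>n. f n t) \<longlonglongrightarrow> g t"
        using t a by (simp add: g_def v_def)
    qed
    then show ?thesis
      by (rule integrable_spike_set) (auto intro: negligible_subset[OF N])
  qed
  moreover have "vector_derivative \<Gamma> (at t) = g t" if "t \<in> {0..} - N" for t
    using that by (auto simp: g_def N_def)
  ultimately show ?thesis using g1 N by (intro that)
qed

lemma op_contour_integral_bound:
  fixes F :: "complex \<Rightarrow> 'a::complex_hilbert \<Rightarrow>\<^sub>L 'a"
  assumes \<Gamma>: "is_contour \<alpha> D \<Gamma>" and F: "continuous_on {0<..} (\<lambda>t. F (\<Gamma> t))"
    and q: "q integrable_on {0..}" and le: "\<And>t. 0 < t \<Longrightarrow> norm (F (\<Gamma> t)) \<le> q t"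
  shows "op_contour_integrable \<Gamma> F" "norm (op_contour_integral \<Gamma> F) \<le> integral {0..} q"
proof -
  obtain g N where N: "negligible N" and gN: "\<And>t. t \<in> {0..} - N \<Longrightarrow> vector_derivative \<Gamma> (at t) = g t"
    and g: "\<And>t. cmod (g t) \<le> 1" "\<And>a b. 0 < a \<Longrightarrow> g integrable_on {a..b}"
    using contour_velocity[OF \<Gamma>] by metis
  note int = scale_op_integrable_on_half_line[OF g(2,1) F q le]
  have eq: "vector_derivative \<Gamma> (at t) \<cdot>\<^sub>C F (\<Gamma> t) = g t \<cdot>\<^sub>C F (\<Gamma> t)" if "t \<in> {0..} - N" for t
    using gN[OF that] by simp
  show "op_contour_integrable \<Gamma> F"
    unfolding op_contour_integrable_def using int(1) N eq by (rule integrable_spike)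
  have "op_contour_integral \<Gamma> F = integral {0..} (\<lambda>t. g t \<cdot>\<^sub>C F (\<Gamma> t))"
    unfolding op_contour_integral_def using N by (rule integral_spike) (simp add: eq)
  then show "norm (op_contour_integral \<Gamma> F) \<le> integral {0..} q"
    using int(2) by simp
qed

text \<open>The end point \<open>\<Gamma> 0\<close>, where nothing is known about \<open>K\<close>, does not affect the integral.\<close>

lemma op_contour_integral_cong:
  assumes "\<And>t. 0 < t \<Longrightarrow> F (\<Gamma> t) = G (\<Gamma> t)"
  shows "op_contour_integral \<Gamma> F = op_contour_integral \<Gamma> G"
  unfolding op_contour_integral_def integral_half_line_open
  by (rule integral_cong) (simp add: assms)

lemma op_contour_integral_add:
  assumes "op_contour_integrable \<Gamma> F" "op_contour_integrable \<Gamma> G"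
  shows "op_contour_integrable \<Gamma> (\<lambda>\<mu>. F \<mu> + G \<mu>)"
    "op_contour_integral \<Gamma> (\<lambda>\<mu>. F \<mu> + G \<mu>) = op_contour_integral \<Gamma> F + op_contour_integral \<Gamma> G"
  using assms unfolding op_contour_integrable_def op_contour_integral_def
  by (simp_all add: bounded_bilinear.add_right[OF bounded_bilinear_scale_op] integrable_add integral_add)

lemma op_contour_integral_diff:
  assumes "op_contour_integrable \<Gamma> F" "op_contour_integrable \<Gamma> G"
  shows "op_contour_integrable \<Gamma> (\<lambda>\<mu>. F \<mu> - G \<mu>)"
    "op_contour_integral \<Gamma> (\<lambda>\<mu>. F \<mu> - G \<mu>) = op_contour_integral \<Gamma> F - op_contour_integral \<Gamma> G"
  using assms unfolding op_contour_integrable_def op_contour_integral_def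
  by (simp_all add: bounded_bilinear.diff_right[OF bounded_bilinear_scale_op] integrable_diff integral_diff)

lemma op_contour_integral_bounded_linear:
  assumes F: "op_contour_integrable \<Gamma> F" and L: "bounded_linear L"
    and comm: "\<And>a T. L (a \<cdot>\<^sub>C T) = a \<cdot>\<^sub>C L T"
  shows "op_contour_integrable \<Gamma> (\<lambda>\<mu>. L (F \<mu>))"
    "op_contour_integral \<Gamma> (\<lambda>\<mu>. L (F \<mu>)) = L (op_contour_integral \<Gamma> F)"
  using integrable_linear[OF F[unfolded op_contour_integrable_def] L]
    integral_linear[OF F[unfolded op_contour_integrable_def] L]
  unfolding op_contour_integrable_def op_contour_integral_def o_def comm by simp_all

lemma op_contour_integral_compose_right:
  assumes F: "op_contour_integrable \<Gamma> F"
  shows "op_contour_integrable \<Gamma> (\<lambda>\<mu>. F \<mu> o\<^sub>L T)"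
    "op_contour_integral \<Gamma> (\<lambda>\<mu>. F \<mu> o\<^sub>L T) = op_contour_integral \<Gamma> F o\<^sub>L T"
  by (rule op_contour_integral_bounded_linear[OF F
        bounded_bilinear.bounded_linear_left[OF bounded_bilinear_blinfun_compose]],
      rule blinfun_eqI, simp)+

lemma op_contour_integral_scale:
  assumes F: "op_contour_integrable \<Gamma> F"
  shows "op_contour_integrable \<Gamma> (\<lambda>\<mu>. z \<cdot>\<^sub>C F \<mu>)"
    "op_contour_integral \<Gamma> (\<lambda>\<mu>. z \<cdot>\<^sub>C F \<mu>) = z \<cdot>\<^sub>C op_contour_integral \<Gamma> F"
  by (rule op_contour_integral_bounded_linear[OF F
        bounded_bilinear.bounded_linear_right[OF bounded_bilinear_scale_op]],
      rule blinfun_eqI, simp add: scaleC_scaleC mult.commute)+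

lemma complex_linear_op_contour_integral:
  assumes F: "op_contour_integrable \<Gamma> F" and lin: "\<And>t. 0 < t \<Longrightarrow> complex_linear (F (\<Gamma> t))"
  shows "complex_linear (op_contour_integral \<Gamma> F)"
  unfolding complex_linear_iff
proof
  fix a
  have "op_contour_integral \<Gamma> F o\<^sub>L scalar_op a = op_contour_integral \<Gamma> (\<lambda>\<mu>. F \<mu> o\<^sub>L scalar_op a)"
    by (rule op_contour_integral_compose_right(2)[OF F, symmetric])
  also have "\<dots> = op_contour_integral \<Gamma> (\<lambda>\<mu>. a \<cdot>\<^sub>C F \<mu>)"
    using lin by (intro op_contour_integral_cong) (simp add: complex_linear_iff)
  also have "\<dots> = a \<cdot>\<^sub>C op_contour_integral \<Gamma> F"
    by (rule op_contour_integral_scale(2)[OF F])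
  finally show "op_contour_integral \<Gamma> F o\<^sub>L scalar_op a = a \<cdot>\<^sub>C op_contour_integral \<Gamma> F" .
qed

text \<open>
  A contour tends to infinity, so off the contour \<open>\<bar>z - \<mu>\<bar>\<close> is not only bounded away from zero but
  grows at least like \<open>1 + \<bar>\<mu>\<bar>\<close>.
\<close>

lemma contour_distance:
  assumes \<Gamma>: "is_contour \<alpha> D \<Gamma>" and z: "z \<notin> \<Gamma> ` {0..}"
  obtains c where "0 < c" "\<And>t. 0 \<le> t \<Longrightarrow> 1 + cmod (\<Gamma> t) \<le> c * cmod (z - \<Gamma> t)"
proof -
  have "\<exists>h. (\<forall>t\<ge>0. h (1 :: real, t) = \<Gamma> t) \<and> (\<forall>R. \<exists>t0\<ge>0. \<forall>s\<in>{0..1}. \<forall>t\<ge>t0. R \<le> cmod (h (s, t)))"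
    using \<Gamma> unfolding is_contour_def deformation_of_half_line_def
    by (elim exE conjE) (intro exI conjI, assumption+)
  then obtain h where h1: "\<forall>t\<ge>0. h (1 :: real, t) = \<Gamma> t"
    and h2: "\<forall>R. \<exists>t0\<ge>0. \<forall>s\<in>{0..1}. \<forall>t\<ge>t0. R \<le> cmod (h (s, t))"
    by (elim exE conjE) (rule that)
  obtain t0 where t0: "0 \<le> t0" and far: "\<forall>s\<in>{0..1}. \<forall>t\<ge>t0. 2 * cmod z + 1 \<le> cmod (h (s, t))"
    using h2[rule_format, of "2 * cmod z + 1"] by (elim exE conjE) (rule that)
  have far: "2 * cmod z + 1 \<le> cmod (\<Gamma> t)" if "t0 \<le> t" for t
    using far[rule_format, of 1 t] h1[rule_format, of t] t0 that by simp
  define \<phi> where "\<phi> t = (1 + cmod (\<Gamma> t)) / cmod (z - \<Gamma> t)" for t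
  have pos: "0 < cmod (z - \<Gamma> t)" if "0 \<le> t" for t
    using z that by auto
  have cont: "continuous_on {0..t0} \<Gamma>"
    using contour_continuous[OF \<Gamma>] by (rule continuous_on_subset) auto
  have "continuous_on {0..t0} \<phi>"
    unfolding \<phi>_def using pos by (intro continuous_intros cont) force
  then have "bounded (\<phi> ` {0..t0})"
    by (intro compact_imp_bounded compact_continuous_image) auto
  then obtain B where B: "\<forall>t\<in>{0..t0}. norm (\<phi> t) \<le> B"
    unfolding bounded_iff by blast
  have "1 + cmod (\<Gamma> t) \<le> max B 4 * cmod (z - \<Gamma> t)" if t: "0 \<le> t" for t
  proof (cases "t \<le> t0")
    case True
    then have "\<phi> t \<le> B" using B[rule_format, of t] t by simp
    then have "1 + cmod (\<Gamma> t) \<le> B * cmod (z - \<Gamma> t)"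
      using pos[OF t] by (simp add: \<phi>_def pos_divide_le_eq)
    then show ?thesis
      using mult_right_mono[of B "max B 4" "cmod (z - \<Gamma> t)"] by simp
  next
    case False
    then have "2 * cmod z + 1 \<le> cmod (\<Gamma> t)" using far by simp
    moreover have "cmod (\<Gamma> t) - cmod z \<le> cmod (z - \<Gamma> t)"
      using norm_triangle_ineq2[of "\<Gamma> t" z] by (simp add: norm_minus_commute)
    ultimately have "1 + cmod (\<Gamma> t) \<le> 4 * cmod (z - \<Gamma> t)"
      by (smt (verit) norm_ge_zero)
    then show ?thesis
      using mult_right_mono[of 4 "max B 4" "cmod (z - \<Gamma> t)"] by simp
  qed
  then show ?thesis by (intro that[of "max B 4"]) auto
qed

lemma borel_measurable_half_line:
  fixes \<phi> :: "real \<Rightarrow> real"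
  assumes "continuous_on {0<..} \<phi>"
  shows "(\<lambda>t. indicator {0..} t *\<^sub>R \<phi> t) \<in> borel_measurable lborel"
proof -
  have "(\<lambda>t. indicator {0<..} t *\<^sub>R \<phi> t) \<in> borel_measurable borel"
    by (intro borel_measurable_continuous_on_indicator assms) auto
  then have "(\<lambda>t. indicator {0<..} t *\<^sub>R \<phi> t + indicator {0} t *\<^sub>R \<phi> 0) \<in> borel_measurable lborel"
    by measurable
  also have "(\<lambda>t. indicator {0<..} t *\<^sub>R \<phi> t + indicator {0} t *\<^sub>R \<phi> 0) = (\<lambda>t. indicator {0..} t *\<^sub>R \<phi> t)"
    by (auto simp: fun_eq_iff indicator_def)
  finally show ?thesis .
qed

lemma set_integrable_half_line_bound:
  fixes \<phi> \<psi> :: "real \<Rightarrow> real"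
  assumes \<psi>: "set_integrable lborel {0..} \<psi>" and cont: "continuous_on {0<..} \<phi>"
    and le: "\<And>t. 0 \<le> t \<Longrightarrow> \<bar>\<phi> t\<bar> \<le> \<psi> t"
  shows "set_integrable lborel {0..} \<phi>"
  unfolding set_integrable_def
proof (rule Bochner_Integration.integrable_bound)
  show "integrable lborel (\<lambda>t. indicator {0..} t *\<^sub>R \<psi> t)"
    using \<psi> unfolding set_integrable_def .
  show "AE t in lborel. norm (indicator {0..} t *\<^sub>R \<phi> t) \<le> norm (indicator {0..} t *\<^sub>R \<psi> t)"
    using le by (intro AE_I2) (force simp: indicator_def)
qed (rule borel_measurable_half_line[OF cont])

text \<open>In the lower half-plane \<open>K\<close> inherits continuity from the isometry \<open>T \<mapsto> T\<^sup>*\<close>.\<close>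

lemma continuous_on_half_domain:
  assumes cont: "continuous_on D K" and refl: "\<forall>\<mu>\<in>D. is_adjoint (K \<mu>) (K (cnj \<mu>))"
  shows "continuous_on (half_domain D l) K"
proof (cases "l = 1")
  case False
  have "continuous_on (cnj ` D) K"
    unfolding continuous_on_iff
  proof (intro ballI allI impI)
    fix \<mu> and e :: real assume \<mu>: "\<mu> \<in> cnj ` D" and e: "0 < e"
    then have "cnj \<mu> \<in> D" by auto
    then obtain d where d: "0 < d" "\<And>\<nu>. \<nu> \<in> D \<Longrightarrow> dist \<nu> (cnj \<mu>) < d \<Longrightarrow> dist (K \<nu>) (K (cnj \<mu>)) < e"
      using cont e unfolding continuous_on_iff by blast
    have "dist (K \<nu>) (K \<mu>) < e" if \<nu>: "\<nu> \<in> cnj ` D" "dist \<nu> \<mu> < d" for \<nu>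
    proof -
      have "cnj \<nu> \<in> D" using \<nu> by auto
      moreover have "dist (cnj \<nu>) (cnj \<mu>) < d"
        using \<nu>(2) by (metis complex_cnj_diff complex_mod_cnj dist_norm)
      ultimately have "dist (K (cnj \<nu>)) (K (cnj \<mu>)) < e" by (rule d(2))
      moreover have "norm (K \<nu> - K \<mu>) \<le> norm (K (cnj \<nu>) - K (cnj \<mu>))"
        using refl[rule_format, OF \<open>cnj \<nu> \<in> D\<close>] refl[rule_format, OF \<open>cnj \<mu> \<in> D\<close>]
        by (intro norm_adjoint_diff_le) simp_all
      ultimately show ?thesis by (simp add: dist_norm)
    qed
    then show "\<exists>d>0. \<forall>\<nu>\<in>cnj ` D. dist \<nu> \<mu> < d \<longrightarrow> dist (K \<nu>) (K \<mu>) < e"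
      using d(1) by blast
  qed
  then show ?thesis using False by (simp add: half_domain_def)
qed (use cont in \<open>simp add: half_domain_def\<close>)

lemma complex_linear_half_domain:
  assumes "\<forall>\<mu>\<in>D. is_adjoint (K \<mu>) (K (cnj \<mu>))" "\<mu> \<in> half_domain D l"
  shows "complex_linear (K \<mu>)"
  using assms by (auto simp: half_domain_def split: if_splits
      dest: is_adjoint_imp_complex_linear is_adjoint_imp_complex_linear[OF is_adjoint_sym])

section \<open>Distances to the spectrum and the radius \<open>r\<^sub>m\<^sub>i\<^sub>n\<close>\<close>

lemma cmod_le_infdist_spectrum:
  assumes "op_spectrum A \<noteq> {}"
  shows "cmod \<mu> \<le> infdist \<mu> (op_spectrum A) + norm A"
proof -
  have "cmod \<mu> - norm A \<le> infdist \<mu> (op_spectrum A)"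
    unfolding infdist_notempty[OF assms]
  proof (rule cINF_greatest[OF assms])
    fix \<nu> assume "\<nu> \<in> op_spectrum A"
    then have "cmod \<nu> \<le> norm A" by (rule spectrum_bound)
    then show "cmod \<mu> - norm A \<le> dist \<mu> \<nu>"
      using norm_triangle_ineq2[of \<mu> \<nu>] by (simp add: dist_norm)
  qed
  then show ?thesis by simp
qed

text \<open>
  Since \<open>A\<close> is selfadjoint, \<open>\<parallel>(A - \<mu>)\<^sup>-\<^sup>1\<parallel> \<le> 1 / dist(\<mu>, \<sigma>(A))\<close>, and perturbing \<open>A\<close> by \<open>X\<close> lowers the
  distance by at most \<open>\<parallel>X\<parallel>\<close>; \<open>X\<close> itself need not be selfadjoint.
\<close>

lemma perturbed_resolvent:
  fixes A X :: "'a::complex_hilbert \<Rightarrow>\<^sub>L 'a"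
  assumes A: "is_adjoint A A" and X: "norm X \<le> r" and r: "r < infdist \<mu> (op_spectrum A)"
  shows "is_inverse (A + X - scalar_op \<mu>) (resolvent (A + X) \<mu>)"
    and "norm (resolvent (A + X) \<mu>) \<le> 1 / (infdist \<mu> (op_spectrum A) - r)"
proof -
  define \<delta> where "\<delta> = infdist \<mu> (op_spectrum A)"
  have \<delta>: "0 < \<delta>" using X r norm_ge_zero[of X] unfolding \<delta>_def by linarith
  note R = selfadjoint_resolvent[OF A \<delta>[unfolded \<delta>_def], folded \<delta>_def]
  have "1 / \<delta> * r < 1" using r \<delta> by (simp add: \<delta>_def)
  then obtain S where S: "is_inverse (A - scalar_op \<mu> + X) S" "norm S \<le> 1 / \<delta> / (1 - 1 / \<delta> * r)"
    using perturbed_inverse[OF R X] by blast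
  have eq: "A - scalar_op \<mu> + X = A + X - scalar_op \<mu>" by simp
  have "S = resolvent (A + X) \<mu>"
    using op_inverse_eq[OF S(1)] unfolding resolvent_def eq by simp
  moreover have "1 / \<delta> / (1 - 1 / \<delta> * r) = 1 / (\<delta> - r)"
    using \<delta> r by (simp add: field_simps \<delta>_def)
  ultimately show "is_inverse (A + X - scalar_op \<mu>) (resolvent (A + X) \<mu>)"
    and "norm (resolvent (A + X) \<mu>) \<le> 1 / (infdist \<mu> (op_spectrum A) - r)"
    using S unfolding eq \<delta>_def by simp_all
qed

lemma VarA_nonneg: "0 \<le> VarA K A \<Gamma>"
  unfolding VarA_def set_lebesgue_integral_def
  by (rule Bochner_Integration.integral_nonneg) (simp add: infdist_nonneg)

lemma r_min_nonneg:
  assumes "0 < d0 A \<Gamma>" "VarA K A \<Gamma> < 1"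
  shows "0 \<le> r_min K A \<Gamma>"
proof -
  have "sqrt ((d0 A \<Gamma>)\<^sup>2 * (1 - VarA K A \<Gamma>)\<^sup>2 / 4 - d0 A \<Gamma> * VarA K A \<Gamma> * norm A)
      \<le> sqrt ((d0 A \<Gamma> * (1 - VarA K A \<Gamma>) / 2)\<^sup>2)"
    using assms VarA_nonneg[of K A \<Gamma>]
    by (intro real_sqrt_le_mono) (simp add: power_mult_distrib power_divide)
  also have "\<dots> = d0 A \<Gamma> * (1 - VarA K A \<Gamma>) / 2" using assms by simp
  finally show ?thesis by (simp add: r_min_def)
qed

text \<open>The condition \<open>\<omega> > 0\<close> says that the radicand in \<open>r\<^sub>m\<^sub>i\<^sub>n\<close> is positive.\<close>

lemma r_min_less:
  assumes "0 < d0 A \<Gamma>" "0 < omega K A \<Gamma>"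
  shows "r_min K A \<Gamma> < d0 A \<Gamma> * (1 - VarA K A \<Gamma>) / 2"
proof -
  have "(d0 A \<Gamma>)\<^sup>2 * (1 - VarA K A \<Gamma>)\<^sup>2 / 4 - d0 A \<Gamma> * VarA K A \<Gamma> * norm A = d0 A \<Gamma> * omega K A \<Gamma> / 4"
    by (simp add: omega_def power2_eq_square field_simps)
  also have "\<dots> > 0" using assms by simp
  finally show ?thesis by (simp add: r_min_def)
qed

text \<open>The radii \<open>r\<^sub>m\<^sub>i\<^sub>n\<close> are bounded below by 0, so that the infimum \<open>r\<^sub>0\<close> is a genuine lower bound.\<close>

lemma r0_le_r_min:
  assumes "is_contour \<alpha> D \<Gamma>" "K_bounded K \<Gamma>" "0 < d0 A \<Gamma>" "VarA K A \<Gamma> < 1" "0 < omega K A \<Gamma>"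
  shows "r0 \<alpha> D K A \<le> r_min K A \<Gamma>"
  unfolding r0_def
proof (rule cInf_lower)
  show "bdd_below {r_min K A \<Gamma> |\<Gamma>. is_contour \<alpha> D \<Gamma> \<and> K_bounded K \<Gamma> \<and>
     0 < d0 A \<Gamma> \<and> VarA K A \<Gamma> < 1 \<and> 0 < omega K A \<Gamma>}"
    by (rule bdd_belowI[of _ 0]) (auto intro: r_min_nonneg)
qed (use assms in blast)

lemma selfadjoint_diff_compose_adjoint:
  assumes A: "is_adjoint A A" and B: "is_adjoint B B'"
  shows "is_adjoint (A - (B o\<^sub>L B')) (A - (B o\<^sub>L B'))"
proof -
  have dl: "cinner (u - v) w = cinner u w - cinner v w" for u v w :: 'a
    using cinner_add_left[of "u - v" v w] by simp
  have dr: "cinner w (u - v) = cinner w u - cinner w v" for u v w :: 'a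
    using dl[of u v w] by (metis cinner_commute complex_cnj_diff)
  show ?thesis
    using A B is_adjoint_sym[OF B] unfolding is_adjoint_def
    by (simp add: blinfun.bilinear_simps dl dr)
qed

section \<open>Integrability along the contour\<close>

lemma K_along_contour:
  assumes cK: "continuous_on D K" and \<Gamma>: "is_contour \<alpha> D \<Gamma>"
  shows "continuous_on {0<..} (\<lambda>t. K (\<Gamma> t))"
  by (rule continuous_on_compose2[OF cK continuous_on_subset[OF contour_continuous[OF \<Gamma>]]])
    (use \<Gamma> in \<open>auto simp: is_contour_def\<close>)

lemma set_integrable_K_bounded:
  assumes cK: "continuous_on {0<..} (\<lambda>t. K (\<Gamma> t))" and \<Gamma>: "is_contour \<alpha> D \<Gamma>" and "K_bounded K \<Gamma>"
  shows "set_integrable lborel {0..} (\<lambda>t. norm (K (\<Gamma> t)) / (1 + cmod (\<Gamma> t)))"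
  unfolding set_integrable_def
proof (rule integrableI_bounded)
  have "continuous_on {0<..} \<Gamma>"
    using contour_continuous[OF \<Gamma>] by (rule continuous_on_subset) auto
  then show "(\<lambda>t. indicator {0..} t *\<^sub>R (norm (K (\<Gamma> t)) / (1 + cmod (\<Gamma> t)))) \<in> borel_measurable lborel"
    using cK
    by (intro borel_measurable_half_line continuous_intros) (simp_all add: add_nonneg_eq_0_iff)
  have "(\<integral>\<^sup>+t. ennreal (norm (indicator {0..} t *\<^sub>R (norm (K (\<Gamma> t)) / (1 + cmod (\<Gamma> t))))) \<partial>lborel)
      = (\<integral>\<^sup>+t\<in>{0..}. ennreal (norm (K (\<Gamma> t)) / (1 + cmod (\<Gamma> t))) \<partial>lborel)"
    by (rule nn_integral_cong) (simp add: indicator_def abs_of_nonneg)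
  then show "(\<integral>\<^sup>+t. ennreal (norm (indicator {0..} t *\<^sub>R (norm (K (\<Gamma> t)) / (1 + cmod (\<Gamma> t))))) \<partial>lborel) < \<infinity>"
    using assms(3) unfolding K_bounded_def by simp
qed

lemma infdist_contour_ge_d0:
  assumes "0 \<le> t"
  shows "d0 A \<Gamma> \<le> infdist (\<Gamma> t) (op_spectrum A)"
  unfolding d0_def infdist_eq_setdist
  by (subst setdist_sym) (use assms in \<open>auto intro!: setdist_le_sing\<close>)

lemma d0_pos_spectrum_nonempty: "0 < d0 A \<Gamma> \<Longrightarrow> op_spectrum A \<noteq> {}"
  by (auto simp: d0_def)

text \<open>
  Since the spectrum is bounded and has positive distance from the contour, the distance from \<open>\<mu>\<close>
  to it is at least a positive multiple of \<open>1 + \<bar>\<mu>\<bar>\<close>. Hence the integrand of the variation is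
  integrable, and the variation is not the default value 0 of a divergent integral.
\<close>

lemma VarA_integral:
  assumes cK: "continuous_on {0<..} (\<lambda>t. K (\<Gamma> t))" and \<Gamma>: "is_contour \<alpha> D \<Gamma>"
    and bdd: "K_bounded K \<Gamma>" and d: "0 < d0 A \<Gamma>"
  shows "(\<lambda>t. norm (K (\<Gamma> t)) / infdist (\<Gamma> t) (op_spectrum A)) integrable_on {0..}"
    and "VarA K A \<Gamma> = integral {0..} (\<lambda>t. norm (K (\<Gamma> t)) / infdist (\<Gamma> t) (op_spectrum A))"
proof -
  define c where "c = (1 + norm A) / d0 A \<Gamma> + 1"
  have "set_integrable lborel {0..} (\<lambda>t. norm (K (\<Gamma> t)) / infdist (\<Gamma> t) (op_spectrum A))"
  proof (rule set_integrable_half_line_bound)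
    show "set_integrable lborel {0..} (\<lambda>t. c * (norm (K (\<Gamma> t)) / (1 + cmod (\<Gamma> t))))"
      using set_integrable_K_bounded[OF cK \<Gamma> bdd] by (rule set_integrable_mult_right)
    have "continuous_on {0<..} \<Gamma>"
      using contour_continuous[OF \<Gamma>] by (rule continuous_on_subset) auto
    moreover have "infdist (\<Gamma> t) (op_spectrum A) \<noteq> 0" if "0 < t" for t
      using infdist_contour_ge_d0[of t A \<Gamma>] d that by auto
    ultimately show "continuous_on {0<..} (\<lambda>t. norm (K (\<Gamma> t)) / infdist (\<Gamma> t) (op_spectrum A))"
      using cK by (intro continuous_intros) auto
    fix t :: real assume t: "0 \<le> t"
    define \<delta> where "\<delta> = infdist (\<Gamma> t) (op_spectrum A)"
    have \<delta>: "d0 A \<Gamma> \<le> \<delta>" using infdist_contour_ge_d0[OF t] by (simp add: \<delta>_def)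
    have "1 + cmod (\<Gamma> t) \<le> (1 + norm A) + \<delta>"
      using cmod_le_infdist_spectrum[OF d0_pos_spectrum_nonempty[OF d], of "\<Gamma> t"] by (simp add: \<delta>_def)
    also have "\<dots> \<le> (1 + norm A) / d0 A \<Gamma> * \<delta> + \<delta>"
      using mult_left_mono[OF \<delta>, of "1 + norm A"] d by (simp add: pos_le_divide_eq)
    also have "\<dots> = c * \<delta>"
      by (simp add: c_def distrib_right)
    finally have le: "1 + cmod (\<Gamma> t) \<le> c * \<delta>" .
    have pos: "0 < \<delta>" "0 < 1 + cmod (\<Gamma> t)" using \<delta> d by (auto simp: add_pos_nonneg)
    have "norm (K (\<Gamma> t)) * (1 + cmod (\<Gamma> t)) \<le> norm (K (\<Gamma> t)) * (c * \<delta>)"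
      using le by (rule mult_left_mono) simp
    then have "norm (K (\<Gamma> t)) / \<delta> \<le> c * (norm (K (\<Gamma> t)) / (1 + cmod (\<Gamma> t)))"
      using pos by (simp add: field_simps)
    then show "\<bar>norm (K (\<Gamma> t)) / infdist (\<Gamma> t) (op_spectrum A)\<bar>
        \<le> c * (norm (K (\<Gamma> t)) / (1 + cmod (\<Gamma> t)))"
      using pos by (simp add: \<delta>_def)
  qed
  note this' = set_borel_integral_eq_integral[OF this]
  show "(\<lambda>t. norm (K (\<Gamma> t)) / infdist (\<Gamma> t) (op_spectrum A)) integrable_on {0..}"
    by (rule this'(1))
  show "VarA K A \<Gamma> = integral {0..} (\<lambda>t. norm (K (\<Gamma> t)) / infdist (\<Gamma> t) (op_spectrum A))"
    unfolding VarA_def by (rule this'(2))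
qed

lemma transfer_integrands_integrable:
  fixes K :: "complex \<Rightarrow> 'a::complex_hilbert \<Rightarrow>\<^sub>L 'a"
  assumes cK: "continuous_on {0<..} (\<lambda>t. K (\<Gamma> t))" and \<Gamma>: "is_contour \<alpha> D \<Gamma>"
    and bdd: "K_bounded K \<Gamma>" and z: "z \<notin> \<Gamma> ` {0..}"
    and cR: "continuous_on {0<..} (\<lambda>t. R (\<Gamma> t))" and R: "\<And>t. 0 < t \<Longrightarrow> norm (R (\<Gamma> t)) \<le> b"
  shows "op_contour_integrable \<Gamma> (\<lambda>\<mu>. (z / (z - \<mu>)) \<cdot>\<^sub>C K \<mu>)"
    and "op_contour_integrable \<Gamma> (\<lambda>\<mu>. inverse (z - \<mu>) \<cdot>\<^sub>C (K \<mu> o\<^sub>L R \<mu>))"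
proof -
  obtain c where c: "0 < c" and far: "\<And>t. 0 \<le> t \<Longrightarrow> 1 + cmod (\<Gamma> t) \<le> c * cmod (z - \<Gamma> t)"
    using contour_distance[OF \<Gamma> z] by metis
  have q: "(\<lambda>t. norm (K (\<Gamma> t)) / (1 + cmod (\<Gamma> t))) integrable_on {0..}"
    using set_borel_integral_eq_integral(1)[OF set_integrable_K_bounded[OF cK \<Gamma> bdd]] .
  have ne: "z - \<Gamma> t \<noteq> 0" if "0 < t" for t using z that by auto
  have c\<Gamma>: "continuous_on {0<..} \<Gamma>"
    using contour_continuous[OF \<Gamma>] by (rule continuous_on_subset) auto
  have inv: "cmod (inverse (z - \<Gamma> t)) * norm (K (\<Gamma> t)) \<le> c * (norm (K (\<Gamma> t)) / (1 + cmod (\<Gamma> t)))"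
    if "0 < t" for t
  proof -
    have "norm (K (\<Gamma> t)) * (1 + cmod (\<Gamma> t)) \<le> norm (K (\<Gamma> t)) * (c * cmod (z - \<Gamma> t))"
      using far[of t] that by (intro mult_left_mono) auto
    moreover have "0 < 1 + cmod (\<Gamma> t)" "0 < cmod (z - \<Gamma> t)"
      using ne[OF that] by (auto simp: add_pos_nonneg)
    ultimately show ?thesis
      unfolding norm_inverse by (simp add: field_simps)
  qed
  show "op_contour_integrable \<Gamma> (\<lambda>\<mu>. (z / (z - \<mu>)) \<cdot>\<^sub>C K \<mu>)"
  proof (rule op_contour_integral_bound(1)[OF \<Gamma>])
    show "continuous_on {0<..} (\<lambda>t. (z / (z - \<Gamma> t)) \<cdot>\<^sub>C K (\<Gamma> t))"
      using ne by (intro bounded_bilinear.continuous_on[OF bounded_bilinear_scale_op] cK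
          continuous_intros c\<Gamma>) auto
    show "(\<lambda>t. cmod z * (c * (norm (K (\<Gamma> t)) / (1 + cmod (\<Gamma> t))))) integrable_on {0..}"
      by (intro integrable_on_mult_right q)
    show "norm ((z / (z - \<Gamma> t)) \<cdot>\<^sub>C K (\<Gamma> t)) \<le> cmod z * (c * (norm (K (\<Gamma> t)) / (1 + cmod (\<Gamma> t))))"
      if "0 < t" for t
      using norm_scale_op_le[of "z / (z - \<Gamma> t)" "K (\<Gamma> t)"] mult_left_mono[OF inv[OF that], of "cmod z"]
      by (simp add: divide_inverse norm_mult mult.assoc)
  qed
  show "op_contour_integrable \<Gamma> (\<lambda>\<mu>. inverse (z - \<mu>) \<cdot>\<^sub>C (K \<mu> o\<^sub>L R \<mu>))"
  proof (rule op_contour_integral_bound(1)[OF \<Gamma>])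
    show "continuous_on {0<..} (\<lambda>t. inverse (z - \<Gamma> t) \<cdot>\<^sub>C (K (\<Gamma> t) o\<^sub>L R (\<Gamma> t)))"
      using ne by (intro bounded_bilinear.continuous_on[OF bounded_bilinear_scale_op]
          bounded_bilinear.continuous_on[OF bounded_bilinear_blinfun_compose] cK cR
          continuous_intros c\<Gamma>) auto
    show "(\<lambda>t. (c * (norm (K (\<Gamma> t)) / (1 + cmod (\<Gamma> t)))) * b) integrable_on {0..}"
      by (intro integrable_on_mult_left integrable_on_mult_right q)
    fix t :: real assume t: "0 < t"
    have b: "0 \<le> b" using R[OF t] norm_ge_zero order_trans by blast
    have "norm (inverse (z - \<Gamma> t) \<cdot>\<^sub>C (K (\<Gamma> t) o\<^sub>L R (\<Gamma> t)))
        \<le> cmod (inverse (z - \<Gamma> t)) * (norm (K (\<Gamma> t)) * b)"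
      by (rule order_trans[OF norm_scale_op_le mult_left_mono[OF order_trans[OF norm_blinfun_compose
              mult_left_mono[OF R[OF t]]]]]) simp_all
    also have "\<dots> \<le> (c * (norm (K (\<Gamma> t)) / (1 + cmod (\<Gamma> t)))) * b"
      using mult_right_mono[OF inv[OF t] b] by (simp add: mult.assoc)
    finally show "norm (inverse (z - \<Gamma> t) \<cdot>\<^sub>C (K (\<Gamma> t) o\<^sub>L R (\<Gamma> t)))
        \<le> (c * (norm (K (\<Gamma> t)) / (1 + cmod (\<Gamma> t)))) * b" .
  qed
qed

section \<open>The identity between the integrands\<close>

text \<open>
  With \<open>R = (H - \<mu>)\<^sup>-\<^sup>1\<close>, from \<open>R (H - z) = I + (\<mu> - z) R\<close> and \<open>H R = I + \<mu> R\<close>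
  the integrand of \<open>V\<^sub>1(H)\<close> is a combination of those of \<open>M\<^sub>1\<close> and \<open>W\<^sub>1\<close>.
\<close>

lemma factorization_integrand:
  fixes K H R :: "'a::complex_hilbert \<Rightarrow>\<^sub>L 'a"
  assumes K: "complex_linear K" and H: "complex_linear H"
    and R: "is_inverse (H - scalar_op \<mu>) R" and z: "z \<noteq> \<mu>"
  shows "K o\<^sub>L H o\<^sub>L R = (z / (z - \<mu>)) \<cdot>\<^sub>C K
    + ((K o\<^sub>L R o\<^sub>L (H - scalar_op z)) - ((z \<cdot>\<^sub>C (inverse (z - \<mu>) \<cdot>\<^sub>C (K o\<^sub>L R))) o\<^sub>L (H - scalar_op z)))"
proof (rule blinfun_eqI)
  fix x
  have R_lin: "complex_linear R"
    using complex_linear_diff[OF H complex_linear_scalar_op] R by (rule complex_linear_inverse)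
  define y where "y = R x"
  have RH: "R (H x) = x + \<mu> *\<^sub>C y"
    using is_inverse_apply(2)[OF R, of x] R_lin
    by (simp add: blinfun.bilinear_simps complex_linear_def y_def algebra_simps)
  have HR: "H y = x + \<mu> *\<^sub>C y"
    using is_inverse_apply(1)[OF R, of x]
    by (simp add: blinfun.bilinear_simps y_def algebra_simps)
  have Rz: "R (z *\<^sub>C x) = z *\<^sub>C y" using R_lin by (simp add: complex_linear_def y_def)
  have K_ap: "K (a *\<^sub>C v) = a *\<^sub>C K v" for a v using K by (simp add: complex_linear_def)
  define u v where "u = K x" and "v = K y"
  define w where "w = z / (z - \<mu>)"
  have "w * (\<mu> - z) = - z" using z by (simp add: w_def field_simps)
  then have wv: "w *\<^sub>C (\<mu> *\<^sub>C v - z *\<^sub>C v) = - (z *\<^sub>C v)"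
    by (metis scaleC_diff_left scaleC_minus_left scaleC_scaleC)
  have "u + \<mu> *\<^sub>C v = w *\<^sub>C u + ((u + \<mu> *\<^sub>C v - z *\<^sub>C v) - w *\<^sub>C (u + (\<mu> *\<^sub>C v - z *\<^sub>C v)))"
    unfolding scaleC_add_right[of w u] wv by simp
  then show "blinfun_apply (K o\<^sub>L H o\<^sub>L R) x = blinfun_apply ((z / (z - \<mu>)) \<cdot>\<^sub>C K
    + ((K o\<^sub>L R o\<^sub>L (H - scalar_op z)) - ((z \<cdot>\<^sub>C (inverse (z - \<mu>) \<cdot>\<^sub>C (K o\<^sub>L R))) o\<^sub>L (H - scalar_op z)))) x"
    by (simp add: blinfun.bilinear_simps HR[unfolded y_def] RH Rz K_ap u_def v_def w_def y_def
        scaleC_scaleC scaleC_add_right scaleC_diff_right divide_inverse algebra_simps)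
qed

lemma transfer_function_factorization:
  fixes K :: "complex \<Rightarrow> 'a::complex_hilbert \<Rightarrow>\<^sub>L 'a"
  assumes K: "\<And>t. 0 < t \<Longrightarrow> complex_linear (K (\<Gamma> t))" and H: "complex_linear H"
    and R: "\<And>t. 0 < t \<Longrightarrow> is_inverse (H - scalar_op (\<Gamma> t)) (resolvent H (\<Gamma> t))"
    and z: "z \<notin> \<Gamma> ` {0..}"
    and i1: "op_contour_integrable \<Gamma> (\<lambda>\<mu>. (z / (z - \<mu>)) \<cdot>\<^sub>C K \<mu>)"
    and i2: "op_contour_integrable \<Gamma> (\<lambda>\<mu>. K \<mu> o\<^sub>L resolvent H \<mu>)"
    and i3: "op_contour_integrable \<Gamma> (\<lambda>\<mu>. inverse (z - \<mu>) \<cdot>\<^sub>C (K \<mu> o\<^sub>L resolvent H \<mu>))"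
    and eq: "H = A + V1 K H \<Gamma>"
  shows "M1 K A \<Gamma> z = W1 K H \<Gamma> z o\<^sub>L (H - scalar_op z)"
proof -
  let ?L = "H - scalar_op z"
  note j2 = op_contour_integral_compose_right[OF i2, of ?L]
  note s3 = op_contour_integral_scale[OF i3, of z]
  note j3 = op_contour_integral_compose_right[OF s3(1), of ?L]
  note d = op_contour_integral_diff[OF j2(1) j3(1)]
  note a = op_contour_integral_add[OF i1 d(1)]
  define I1 where "I1 = op_contour_integral \<Gamma> (\<lambda>\<mu>. (z / (z - \<mu>)) \<cdot>\<^sub>C K \<mu>)"
  define I2 where "I2 = op_contour_integral \<Gamma> (\<lambda>\<mu>. K \<mu> o\<^sub>L resolvent H \<mu>)"
  define I3 where "I3 = op_contour_integral \<Gamma> (\<lambda>\<mu>. inverse (z - \<mu>) \<cdot>\<^sub>C (K \<mu> o\<^sub>L resolvent H \<mu>))"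
  have V: "V1 K H \<Gamma> = I1 + ((I2 o\<^sub>L ?L) - ((z \<cdot>\<^sub>C I3) o\<^sub>L ?L))"
    unfolding V1_def I1_def I2_def I3_def s3(2)[symmetric] j2(2)[symmetric] j3(2)[symmetric]
      d(2)[symmetric] a(2)[symmetric]
  proof (rule op_contour_integral_cong)
    fix t :: real assume t: "0 < t"
    have "z \<noteq> \<Gamma> t" using z t by auto
    from factorization_integrand[OF K[OF t] H R[OF t] this]
    show "K (\<Gamma> t) o\<^sub>L H o\<^sub>L resolvent H (\<Gamma> t) = (z / (z - \<Gamma> t)) \<cdot>\<^sub>C K (\<Gamma> t)
      + ((K (\<Gamma> t) o\<^sub>L resolvent H (\<Gamma> t) o\<^sub>L ?L)
        - ((z \<cdot>\<^sub>C (inverse (z - \<Gamma> t) \<cdot>\<^sub>C (K (\<Gamma> t) o\<^sub>L resolvent H (\<Gamma> t)))) o\<^sub>L ?L))" .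
  qed
  show ?thesis
  proof (rule blinfun_eqI)
    fix x
    have "blinfun_apply H x = blinfun_apply (A + (I1 + ((I2 o\<^sub>L ?L) - ((z \<cdot>\<^sub>C I3) o\<^sub>L ?L)))) x"
      by (subst eq) (simp only: V)
    then show "blinfun_apply (M1 K A \<Gamma> z) x = blinfun_apply (W1 K H \<Gamma> z o\<^sub>L ?L) x"
      unfolding M1_def W1_def I1_def[symmetric] I2_def[symmetric] I3_def[symmetric]
      by (simp add: blinfun.bilinear_simps algebra_simps)
  qed
qed

lemma complex_linear_W1:
  assumes K: "\<And>t. 0 < t \<Longrightarrow> complex_linear (K (\<Gamma> t))" and H: "complex_linear H"
    and R: "\<And>t. 0 < t \<Longrightarrow> is_inverse (H - scalar_op (\<Gamma> t)) (resolvent H (\<Gamma> t))"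
    and i2: "op_contour_integrable \<Gamma> (\<lambda>\<mu>. K \<mu> o\<^sub>L resolvent H \<mu>)"
    and i3: "op_contour_integrable \<Gamma> (\<lambda>\<mu>. inverse (z - \<mu>) \<cdot>\<^sub>C (K \<mu> o\<^sub>L resolvent H \<mu>))"
  shows "complex_linear (W1 K H \<Gamma> z)"
proof -
  have KR: "complex_linear (K (\<Gamma> t) o\<^sub>L resolvent H (\<Gamma> t))" if t: "0 < t" for t
    by (intro complex_linear_compose K t complex_linear_inverse[OF _ R]
        complex_linear_diff H complex_linear_scalar_op)
  show ?thesis
    unfolding W1_def
    by (intro complex_linear_add complex_linear_diff complex_linear_id complex_linear_scale
        complex_linear_op_contour_integral i2 i3 KR)
qed

text \<open>
  The two integrals in \<open>W\<^sub>1\<close> combine: \<open>I - W\<^sub>1(z) = - \<integral> d\<mu> (\<mu> / (z - \<mu>)) K(\<mu>) R(\<mu>)\<close>, where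
  \<open>R\<close> is the resolvent of \<open>H\<close>.
\<close>

lemma W1_near_id:
  fixes K :: "complex \<Rightarrow> 'a::complex_hilbert \<Rightarrow>\<^sub>L 'a"
  assumes \<Gamma>: "is_contour \<alpha> D \<Gamma>" and z: "z \<notin> \<Gamma> ` {0..}"
    and cK: "continuous_on {0<..} (\<lambda>t. K (\<Gamma> t))"
    and cR: "continuous_on {0<..} (\<lambda>t. resolvent H (\<Gamma> t))"
    and i2: "op_contour_integrable \<Gamma> (\<lambda>\<mu>. K \<mu> o\<^sub>L resolvent H \<mu>)"
    and i3: "op_contour_integrable \<Gamma> (\<lambda>\<mu>. inverse (z - \<mu>) \<cdot>\<^sub>C (K \<mu> o\<^sub>L resolvent H \<mu>))"
    and q: "q integrable_on {0..}"
    and le: "\<And>t. 0 < t \<Longrightarrow>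
      cmod (\<Gamma> t) / cmod (z - \<Gamma> t) * (norm (K (\<Gamma> t)) * norm (resolvent H (\<Gamma> t))) \<le> q t"
  obtains T where "W1 K H \<Gamma> z = id_blinfun - T" "norm T \<le> integral {0..} q"
proof -
  define F where "F \<mu> = (K \<mu> o\<^sub>L resolvent H \<mu>) - z \<cdot>\<^sub>C (inverse (z - \<mu>) \<cdot>\<^sub>C (K \<mu> o\<^sub>L resolvent H \<mu>))" for \<mu>
  note s3 = op_contour_integral_scale[OF i3, of z]
  have "W1 K H \<Gamma> z = id_blinfun - op_contour_integral \<Gamma> F"
    unfolding W1_def F_def op_contour_integral_diff(2)[OF i2 s3(1)] s3(2) by simp
  moreover have "norm (op_contour_integral \<Gamma> F) \<le> integral {0..} q"
  proof (rule op_contour_integral_bound(2)[OF \<Gamma> _ q])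
    have ne: "z - \<Gamma> t \<noteq> 0" if "0 < t" for t using z that by auto
    have c\<Gamma>: "continuous_on {0<..} \<Gamma>"
      using contour_continuous[OF \<Gamma>] by (rule continuous_on_subset) auto
    show "continuous_on {0<..} (\<lambda>t. F (\<Gamma> t))"
      unfolding F_def
      using ne by (intro bounded_bilinear.continuous_on[OF bounded_bilinear_scale_op]
          bounded_bilinear.continuous_on[OF bounded_bilinear_blinfun_compose] cK cR
          continuous_intros c\<Gamma>) auto
    fix t :: real assume t: "0 < t"
    define S where "S = K (\<Gamma> t) o\<^sub>L resolvent H (\<Gamma> t)"
    have "1 - z * inverse (z - \<Gamma> t) = - (\<Gamma> t / (z - \<Gamma> t))"
      using ne[OF t] by (simp add: field_simps)
    moreover have "F (\<Gamma> t) = (1 - z * inverse (z - \<Gamma> t)) \<cdot>\<^sub>C S"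
      unfolding F_def S_def
      by (rule blinfun_eqI) (simp add: blinfun.bilinear_simps scaleC_diff_left scaleC_scaleC)
    ultimately have "norm (F (\<Gamma> t)) \<le> cmod (\<Gamma> t) / cmod (z - \<Gamma> t) * norm S"
      using norm_scale_op_le[of "- (\<Gamma> t / (z - \<Gamma> t))" S] by (simp add: norm_divide)
    also have "\<dots> \<le> cmod (\<Gamma> t) / cmod (z - \<Gamma> t) * (norm (K (\<Gamma> t)) * norm (resolvent H (\<Gamma> t)))"
      unfolding S_def by (intro mult_left_mono norm_blinfun_compose) simp
    also have "\<dots> \<le> q t" by (rule le[OF t])
    finally show "norm (F (\<Gamma> t)) \<le> q t" .
  qed
  ultimately show ?thesis by (rule that)
qed

section \<open>Factorization of \<open>M\<^sub>1\<close> and invertibility of \<open>W\<^sub>1\<close>\<close>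

theorem theorem3p1:
  fixes \<alpha>0 C \<gamma> :: real
    and DA :: "'h0::{complex_hilbert, second_countable_topology} set"
    and A0 :: "'h0 \<Rightarrow> 'h0"
    and E0 :: "real set \<Rightarrow> 'h0 \<Rightarrow>\<^sub>L 'h0"
    and A0_inv_sqrt :: "'h0 \<Rightarrow>\<^sub>L 'h0"
    and A1 At X H1 :: "'h1::{complex_hilbert, second_countable_topology} \<Rightarrow>\<^sub>L 'h1"
    and D01 :: "'h1 set" and T01 :: "'h1 \<Rightarrow> 'h0"
    and D10 :: "'h0 set" and T10 :: "'h0 \<Rightarrow> 'h1"
    and B10 :: "'h0 \<Rightarrow>\<^sub>L 'h1" and B01 :: "'h1 \<Rightarrow>\<^sub>L 'h0"
    and KB :: "real \<Rightarrow> 'h1 \<Rightarrow>\<^sub>L 'h1"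
    and K :: "complex \<Rightarrow> 'h1 \<Rightarrow>\<^sub>L 'h1"
    and Dp :: "complex set"
    and l :: int
    and \<Gamma> :: "real \<Rightarrow> complex"
  assumes alpha0: "0 < \<alpha>0"
    and A0: "selfadjoint_operator DA A0"
    and A0_spectrum: "operator_spectrum DA A0 = complex_of_real ` {\<alpha>0..}"
    and E0: "is_spectral_measure E0 DA A0"
    and A0_ac: "absolutely_continuous_spectrum E0"
    and A1: "is_adjoint A1 A1"
    and T01: "linear_operator D01 T01"
    and T10: "linear_operator D10 T10"
    and T_adjoint: "operator_adjoint D01 T01 D10 T10"
    and T10_domain: "spectral_domain E0 sqrt \<subseteq> D10"
    and A0_inv_sqrt: "is_spectral_integral E0 (\<lambda>s. 1 / sqrt s) UNIV (blinfun_apply A0_inv_sqrt)"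
    and B10: "\<forall>x. B10 x = T10 (A0_inv_sqrt x)"
    and B01: "is_adjoint B10 B01"
    and At: "At = A1 - (B10 o\<^sub>L B01)"
    and At_spectrum: "op_spectrum At \<subseteq> complex_of_real ` {\<alpha>0..}"
    and KB: "\<forall>s. KB s = B10 o\<^sub>L E0 {\<alpha>0..<s} o\<^sub>L B01"
    and Dp: "open Dp" "connected Dp" "simply_connected Dp" "Dp \<subseteq> {z. 0 < Im z}"
      "complex_of_real ` {\<alpha>0..} \<subseteq> frontier Dp"
    and KB_derivative: "\<forall>s>\<alpha>0. (KB has_vector_derivative K (complex_of_real s)) (at s)"
    and K_continuous: "continuous_on (Dp \<union> complex_of_real ` {\<alpha>0<..}) K"
    and K_holomorphic: "op_holomorphic_on K Dp"
    and K_reflection: "\<forall>\<mu>\<in>Dp. is_adjoint (K \<mu>) (K (cnj \<mu>))"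
    and K_bound: "0 < C" "-1 < \<gamma>" "\<gamma> \<le> 0"
      "\<forall>\<mu>\<in>Dp \<union> cnj ` Dp. norm (K \<mu>) \<le> C * cmod (\<mu> - complex_of_real \<alpha>0) powr \<gamma>"
    and l: "l \<in> {1, -1}"
    and contour: "is_contour \<alpha>0 (half_domain Dp l) \<Gamma>"
    and K_bounded: "K_bounded K \<Gamma>"
    and d0_pos: "0 < d0 At \<Gamma>"
    and Var_less_1: "VarA K At \<Gamma> < 1"
    and Var_norm: "VarA K At \<Gamma> * norm At < 1 / 4 * d0 At \<Gamma> * (1 - VarA K At \<Gamma>)\<^sup>2"
    and X_linear: "complex_linear X"
    and X_solution: "X = V1 K (At + X) \<Gamma>"
    and X_norm: "norm X \<le> r0 \<alpha>0 (half_domain Dp l) K At"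
    and H1: "H1 = At + X"
  shows "(\<forall>z. z \<notin> \<Gamma> ` {0..} \<longrightarrow>
      op_contour_integrable \<Gamma> (\<lambda>\<mu>. (z / (z - \<mu>)) \<cdot>\<^sub>C K \<mu>) \<and>
      op_contour_integrable \<Gamma> (\<lambda>\<mu>. K \<mu> o\<^sub>L resolvent H1 \<mu>) \<and>
      op_contour_integrable \<Gamma> (\<lambda>\<mu>. inverse (z - \<mu>) \<cdot>\<^sub>C (K \<mu> o\<^sub>L resolvent H1 \<mu>)) \<and>
      complex_linear (W1 K H1 \<Gamma> z) \<and>
      M1 K At \<Gamma> z = W1 K H1 \<Gamma> z o\<^sub>L (H1 - scalar_op z)) \<and>
    (\<forall>z. infdist z (op_spectrum At) \<le> d0 At \<Gamma> * (1 - VarA K At \<Gamma>) / 2 \<longrightarrow>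
      op_invertible (W1 K H1 \<Gamma> z) \<and>
      0 < 1 - 4 * VarA K At \<Gamma> * (d0 At \<Gamma> + norm At) / (d0 At \<Gamma> * (1 + VarA K At \<Gamma>)\<^sup>2) \<and>
      norm (op_inverse (W1 K H1 \<Gamma> z)) \<le>
        inverse (1 - 4 * VarA K At \<Gamma> * (d0 At \<Gamma> + norm At) / (d0 At \<Gamma> * (1 + VarA K At \<Gamma>)\<^sup>2)))"
proof -
  define D where "D = half_domain Dp l"
  define d V a \<delta> where "d = d0 At \<Gamma>" and "V = VarA K At \<Gamma>" and "a = norm At"
    and "\<delta> t = infdist (\<Gamma> t) (op_spectrum At)" for t
  define r where "r = d * (1 - V) / 2"
  define R where "R = resolvent H1"
  have d: "0 < d" and V: "V < 1" "0 \<le> V" and a: "0 \<le> a"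
    using d0_pos Var_less_1 VarA_nonneg by (simp_all add: d_def V_def a_def)
  have sa: "is_adjoint At At"
    unfolding At using A1 B01 by (rule selfadjoint_diff_compose_adjoint)
  have \<Gamma>: "is_contour \<alpha>0 D \<Gamma>" using contour by (simp add: D_def)
  have \<Gamma>_D: "\<Gamma> t \<in> D" if "0 < t" for t
    using \<Gamma> that unfolding is_contour_def by blast
  have c\<Gamma>: "continuous_on {0<..} \<Gamma>"
    using contour_continuous[OF \<Gamma>] by (rule continuous_on_subset) auto
  have "continuous_on Dp K"
    using K_continuous by (rule continuous_on_subset) simp
  then have "continuous_on D K"
    unfolding D_def using K_reflection by (rule continuous_on_half_domain)
  then have cK: "continuous_on {0<..} (\<lambda>t. K (\<Gamma> t))"
    using \<Gamma> by (rule K_along_contour)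
  have K_lin: "complex_linear (K (\<Gamma> t))" if "0 < t" for t
    using K_reflection \<Gamma>_D[OF that] unfolding D_def by (rule complex_linear_half_domain)
  have H_lin: "complex_linear H1"
    unfolding H1 by (intro complex_linear_add is_adjoint_imp_complex_linear[OF sa] X_linear)

  have "4 * V * a < d * (1 - V)\<^sup>2"
    using Var_norm by (simp add: V_def a_def d_def)
  then have omega: "0 < omega K At \<Gamma>"
    by (simp add: omega_def V_def a_def d_def mult.commute mult.left_commute)
  have "norm X \<le> r_min K At \<Gamma>"
    using X_norm r0_le_r_min[OF contour K_bounded d0_pos Var_less_1 omega] by (rule order_trans)
  then have X: "norm X \<le> r"
    using r_min_less[OF d0_pos omega] by (simp add: r_def d_def V_def)

  have \<delta>_ge: "d \<le> \<delta> t" if "0 < t" for t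
    using infdist_contour_ge_d0[of t At \<Gamma>] that by (simp add: d_def \<delta>_def)
  \<comment> \<open>As \<open>\<delta> t \<ge> d\<close>, removing \<open>r = d (1 - V) / 2\<close> from \<open>\<delta> t\<close> costs at most the factor \<open>(1 + V) / 2\<close>.\<close>
  have \<delta>_r: "\<delta> t * (1 + V) / 2 \<le> \<delta> t - r" if "0 < t" for t
    using mult_right_mono[OF \<delta>_ge[OF that], of "1 - V"] V by (simp add: r_def field_simps)
  have r_less: "r < \<delta> t" if "0 < t" for t
  proof -
    have "0 < \<delta> t * (1 + V)" using \<delta>_ge[OF that] d V by simp
    then show ?thesis using \<delta>_r[OF that] by simp
  qed
  note res = perturbed_resolvent[OF sa X, folded H1]
  have R: "is_inverse (H1 - scalar_op (\<Gamma> t)) (R (\<Gamma> t))" if "0 < t" for t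
    unfolding R_def by (rule res(1)) (use r_less[OF that] in \<open>simp add: \<delta>_def\<close>)
  have R_le: "norm (R (\<Gamma> t)) \<le> 2 / (\<delta> t * (1 + V))" if "0 < t" for t
  proof -
    have pos: "0 < \<delta> t * (1 + V) / 2" using \<delta>_ge[OF that] d V by simp
    have "norm (R (\<Gamma> t)) \<le> 1 / (\<delta> t - r)"
      unfolding R_def \<delta>_def by (rule res(2)) (use r_less[OF that] in \<open>simp add: \<delta>_def\<close>)
    also have "\<dots> \<le> 1 / (\<delta> t * (1 + V) / 2)"
      using \<delta>_r[OF that] pos by (intro divide_left_mono) auto
    finally show ?thesis by simp
  qed
  have R_le_d: "norm (R (\<Gamma> t)) \<le> 2 / d" if "0 < t" for t
  proof -
    have "d * 1 \<le> \<delta> t * (1 + V)"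
      using \<delta>_ge[OF that] d V by (intro mult_mono) auto
    then have "2 / (\<delta> t * (1 + V)) \<le> 2 / d"
      using d by (intro divide_left_mono) auto
    then show ?thesis using R_le[OF that] by linarith
  qed
  have cR: "continuous_on {0<..} (\<lambda>t. R (\<Gamma> t))"
  proof (rule continuous_on_inverse)
    have "continuous_on {0<..} (\<lambda>t. H1 - \<Gamma> t \<cdot>\<^sub>C id_blinfun)"
      by (intro continuous_intros bounded_bilinear.continuous_on[OF bounded_bilinear_scale_op] c\<Gamma>)
    moreover have "\<Gamma> t \<cdot>\<^sub>C id_blinfun = (scalar_op (\<Gamma> t) :: 'h1 \<Rightarrow>\<^sub>L 'h1)" for t
      by (rule blinfun_eqI) simp
    ultimately show "continuous_on {0<..} (\<lambda>t. H1 - scalar_op (\<Gamma> t))" by simp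
  qed (use R R_le_d in auto)

  define q where "q t = norm (K (\<Gamma> t)) / \<delta> t" for t
  have q: "q integrable_on {0..}" "V = integral {0..} q"
    using VarA_integral[OF cK \<Gamma> K_bounded d0_pos] by (simp_all add: q_def[abs_def] \<delta>_def V_def)
  have i2: "op_contour_integrable \<Gamma> (\<lambda>\<mu>. K \<mu> o\<^sub>L R \<mu>)"
  proof (rule op_contour_integral_bound(1)[OF \<Gamma>])
    show "continuous_on {0<..} (\<lambda>t. K (\<Gamma> t) o\<^sub>L R (\<Gamma> t))"
      by (intro bounded_bilinear.continuous_on[OF bounded_bilinear_blinfun_compose] cK cR)
    show "(\<lambda>t. 2 * q t) integrable_on {0..}"
      using q(1) by (rule integrable_on_mult_right)
    fix t :: real assume t: "0 < t"
    have \<delta>: "0 < \<delta> t" using \<delta>_ge[OF t] d by simp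
    have "\<delta> t * 1 \<le> \<delta> t * (1 + V)" using V \<delta> by (intro mult_left_mono) auto
    then have "2 / (\<delta> t * (1 + V)) \<le> 2 / \<delta> t"
      using \<delta> by (intro divide_left_mono) auto
    then have "norm (R (\<Gamma> t)) \<le> 2 / \<delta> t" using R_le[OF t] by linarith
    then have "norm (K (\<Gamma> t)) * norm (R (\<Gamma> t)) \<le> norm (K (\<Gamma> t)) * (2 / \<delta> t)"
      by (rule mult_left_mono) simp
    then show "norm (K (\<Gamma> t) o\<^sub>L R (\<Gamma> t)) \<le> 2 * q t"
      using norm_blinfun_compose[of "K (\<Gamma> t)" "R (\<Gamma> t)"] by (simp add: q_def mult.commute)
  qed
  note i13 = transfer_integrands_integrable[OF cK \<Gamma> K_bounded _ cR R_le_d]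
  have first: "op_contour_integrable \<Gamma> (\<lambda>\<mu>. (z / (z - \<mu>)) \<cdot>\<^sub>C K \<mu>) \<and>
      op_contour_integrable \<Gamma> (\<lambda>\<mu>. K \<mu> o\<^sub>L resolvent H1 \<mu>) \<and>
      op_contour_integrable \<Gamma> (\<lambda>\<mu>. inverse (z - \<mu>) \<cdot>\<^sub>C (K \<mu> o\<^sub>L resolvent H1 \<mu>)) \<and>
      complex_linear (W1 K H1 \<Gamma> z) \<and>
      M1 K At \<Gamma> z = W1 K H1 \<Gamma> z o\<^sub>L (H1 - scalar_op z)" if z: "z \<notin> \<Gamma> ` {0..}" for z
  proof -
    have eq: "H1 = At + V1 K H1 \<Gamma>" using X_solution unfolding H1[symmetric] by (simp add: H1)
    show ?thesis
      using transfer_function_factorization[OF K_lin H_lin R[unfolded R_def] z i13(1)[OF z]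
          i2[unfolded R_def] i13(2)[OF z, unfolded R_def] eq]
        complex_linear_W1[OF K_lin H_lin R[unfolded R_def] i2[unfolded R_def]
          i13(2)[OF z, unfolded R_def]]
        i13(1)[OF z] i2[unfolded R_def] i13(2)[OF z, unfolded R_def]
      by blast
  qed

  define Q where "Q = 4 * V * (d + a) / (d * (1 + V)\<^sup>2)"
  \<comment> \<open>Equivalent to the smallness hypothesis, by \<open>(1 + V)\<^sup>2 = (1 - V)\<^sup>2 + 4 V\<close>.\<close>
  have Q: "Q < 1"
  proof -
    have "4 * V * (d + a) < d * (1 + V)\<^sup>2"
      using \<open>4 * V * a < d * (1 - V)\<^sup>2\<close> by (simp add: power2_eq_square algebra_simps)
    then show ?thesis using d V by (simp add: Q_def)
  qed
  have second: "op_invertible (W1 K H1 \<Gamma> z) \<and> norm (op_inverse (W1 K H1 \<Gamma> z)) \<le> inverse (1 - Q)"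
    if z: "infdist z (op_spectrum At) \<le> r" for z
  proof -
    have far: "\<delta> t * (1 + V) / 2 \<le> cmod (z - \<Gamma> t)" if "0 < t" for t
      using infdist_triangle[of "\<Gamma> t" "op_spectrum At" z] z \<delta>_r[OF that]
      by (simp add: \<delta>_def dist_norm norm_minus_commute)
    have "z \<noteq> \<Gamma> t" if "0 \<le> t" for t
    proof
      assume "z = \<Gamma> t"
      then have "d \<le> r" using z infdist_contour_ge_d0[OF that, of At \<Gamma>] by (simp add: d_def)
      moreover have "0 < d * (1 + V)" using d V by simp
      ultimately show False by (simp add: r_def algebra_simps)
    qed
    then have zn: "z \<notin> \<Gamma> ` {0..}" by auto
    define c where "c = 4 * (d + a) / (d * (1 + V)\<^sup>2)"
    obtain T where T: "W1 K H1 \<Gamma> z = id_blinfun - T" "norm T \<le> integral {0..} (\<lambda>t. c * q t)"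
    proof (rule W1_near_id[OF \<Gamma> zn cK cR[unfolded R_def] i2[unfolded R_def]
          i13(2)[OF zn, unfolded R_def]])
      show "(\<lambda>t. c * q t) integrable_on {0..}"
        using q(1) by (rule integrable_on_mult_right)
      fix t :: real assume t: "0 < t"
      have \<delta>: "0 < \<delta> t" using \<delta>_ge[OF t] d by simp
      have "cmod (\<Gamma> t) \<le> \<delta> t + a"
        using cmod_le_infdist_spectrum[OF d0_pos_spectrum_nonempty[OF d0_pos], of "\<Gamma> t"]
        by (simp add: \<delta>_def a_def)
      then have "cmod (\<Gamma> t) / cmod (z - \<Gamma> t) \<le> (\<delta> t + a) / (\<delta> t * (1 + V) / 2)"
        using far[OF t] \<delta> V a by (intro frac_le) auto
      also have "\<dots> \<le> (2 / (1 + V)) * ((d + a) / d)"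
      proof -
        have "(\<delta> t + a) / \<delta> t \<le> (d + a) / d"
          using \<delta>_ge[OF t] d \<delta> a by (simp add: add_divide_distrib divide_left_mono)
        then have "(2 / (1 + V)) * ((\<delta> t + a) / \<delta> t) \<le> (2 / (1 + V)) * ((d + a) / d)"
          using V by (intro mult_left_mono) auto
        then show ?thesis by (simp add: mult.commute)
      qed
      finally have "cmod (\<Gamma> t) / cmod (z - \<Gamma> t) * (norm (K (\<Gamma> t)) * norm (R (\<Gamma> t)))
          \<le> (2 / (1 + V)) * ((d + a) / d) * (norm (K (\<Gamma> t)) * (2 / (\<delta> t * (1 + V))))"
        using R_le[OF t] V d a by (intro mult_mono) auto
      also have "\<dots> = c * q t"
        using V d \<delta> by (simp add: c_def q_def power2_eq_square add_nonneg_eq_0_iff field_simps)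
      finally show "cmod (\<Gamma> t) / cmod (z - \<Gamma> t) * (norm (K (\<Gamma> t)) * norm (resolvent H1 (\<Gamma> t)))
          \<le> c * q t" unfolding R_def .
    qed (auto intro: that)
    have "norm T \<le> Q"
      using T(2) by (simp add: integral_mult_right q(2)[symmetric] c_def Q_def mult_ac)
    then obtain S where "is_inverse (W1 K H1 \<Gamma> z) S" "norm S \<le> inverse (1 - Q)"
      using neumann_inverse[OF _ Q] unfolding T(1) by blast
    then show ?thesis
      using op_inverse_eq unfolding op_invertible_def by blast
  qed
  show ?thesis
    using first second Q unfolding Q_def V_def d_def a_def r_def by auto
qed

end
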